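(* There exist a Bloch function $b\in\mathcal{B}$ and an interpolating sequence $(z_n)_{n\in\mathbb{N}}$ in $\mathbb{D}\setminus\{0\}$ such that for every $\lambda>0$, $$\sum_{n\in\mathbb{N}}\exp\!\left(\frac{\lambda|b(z_n)-b(0)|^2}{-\log(1-|z_n|^2)}\right)(1-|z_n|^2)=\infty.$$
   Context: $\mathbb{D}$ is the open unit disc. The Bloch space $\mathcal{B}$ is the space of holomorphic $b$ on $\mathbb{D}$ with $\|b\|_{\mathcal{B}}=|b(0)|+\sup_{z\in\mathbb{D}}|b'(z)|(1-|z|^2)<\infty$. A sequence $(z_n)$ in $\mathbb{D}$ is interpolating (for $H^\infty$) if for every bounded sequence $(w_n)$ there is a bounded holomorphic $\phi$ on $\mathbb{D}$ with $\phi(z_n)=w_n$ for all $n$; equivalently (Carleson), $\inf_{n\ne j}\rho(z_n,z_j)>0$ and $\sup_{z\in\mathbb{D}}\sum_n(1-\rho^2(z,z_n))<\infty$, where $\rho(z,w)=\left|\frac{w-z}{1-\bar wz}\right|$. *)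

theory Defs
  imports "HOL-Complex_Analysis.Complex_Analysis"
begin

definition bloch :: "(complex \<Rightarrow> complex) \<Rightarrow> bool" where
  "bloch b \<longleftrightarrow> b holomorphic_on ball 0 1 \<and>
     (\<exists>C. \<forall>z\<in>ball 0 1. norm (deriv b z) * (1 - (norm z)\<^sup>2) \<le> C)"

definition interpolating :: "(nat \<Rightarrow> complex) \<Rightarrow> bool" where
  "interpolating z \<longleftrightarrow> (\<forall>n. z n \<in> ball 0 1) \<and>
     (\<forall>w::nat \<Rightarrow> complex. bounded (range w) \<longrightarrow>
        (\<exists>\<phi>. \<phi> holomorphic_on ball 0 1 \<and> bounded (\<phi> ` ball 0 1) \<and>
             (\<forall>n. \<phi> (z n) = w n)))"

end

theory Submission
  imports Defs "HOL-Real_Asymp.Real_Asymp"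
begin

text \<open>
  Take the lacunary function \<open>b(z) = \<Sum> z^(4^n)\<close>. On the circle \<open>|z| = 1 - 4^(-k)\<close> it is, up to a
  bounded error, a sum of \<open>k\<close> characters that behaves like a random walk of length \<open>k\<close>, so for every
  \<open>s\<close> a fraction of at least \<open>c^s\<close> of the circle satisfies \<open>|b|^2 \<ge> c' s k\<close> with fixed constants
  \<open>c, c' > 0\<close>. The points are placed on circles of rapidly increasing depth, the \<open>i\<close>-th generation
  being a fraction of about \<open>e_i\<close> of a full grid on which \<open>|b|^2 \<ge> c' s_i k\<close>. Here \<open>\<Sum> e_i\<close> converges,
  \<open>\<Sum> e_i^(1-\<tau>)\<close> diverges for all \<open>\<tau> > 0\<close>, and \<open>s_i\<close> is of order \<open>log (1/e_i)\<close>. Then the \<open>i\<close>-th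
  generation contributes at least a constant times \<open>e_i^(1-\<tau>)\<close> to the sum, with \<open>\<tau>\<close> proportional
  to \<open>\<lambda>\<close>. Only the base 4 digits between two consecutive depths decide whether a grid point is
  selected, so each generation is equidistributed at the scale of all earlier ones; this makes
  the sequence a Carleson sequence because \<open>\<Sum> e_i\<close> converges.
\<close>

section \<open>Carleson sequences are interpolating\<close>

text \<open>Ordered by decreasing \<open>v\<close>, the summands form a lower Riemann sum for the
  integral of exp (-t) over the interval from 0 to \<open>sum a F\<close>; ties only make them
  smaller. The induction inserts an element of least \<open>v\<close> last, so that its tail is the
  whole set.\<close>

lemma sum_mult_exp_neg_tail_le_1:
  fixes a v :: "'a \<Rightarrow> real"
  assumes "finite F" and "\<And>j. j \<in> F \<Longrightarrow> 0 \<le> a j"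
  shows "(\<Sum>j\<in>F. a j * exp (- (\<Sum>k\<in>{k\<in>F. v j \<le> v k}. a k))) \<le> 1 - exp (- sum a F)"
  using assms
proof (induction F rule: finite_ranking_induct[where f = "\<lambda>x. - v x"])
  case empty
  then show ?case by simp
next
  case (insert x S)
  show ?case
  proof (cases "x \<in> S")
    case True
    thus ?thesis using insert by (simp add: insert_absorb)
  next
    case False
    have pos: "0 \<le> a j" if "j \<in> insert x S" for j
      using insert.prems that by blast
    have "{k \<in> insert x S. v x \<le> v k} = insert x S"
      using insert.hyps by force
    with False insert.hyps have "(\<Sum>j\<in>insert x S. a j * exp (- (\<Sum>k\<in>{k\<in>insert x S. v j \<le> v k}. a k)))
       = a x * exp (- sum a (insert x S))
         + (\<Sum>j\<in>S. a j * exp (- (\<Sum>k\<in>{k\<in>insert x S. v j \<le> v k}. a k)))"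
      by (subst sum.insert) simp_all
    also have "(\<Sum>j\<in>S. a j * exp (- (\<Sum>k\<in>{k\<in>insert x S. v j \<le> v k}. a k)))
        \<le> (\<Sum>j\<in>S. a j * exp (- (\<Sum>k\<in>{k\<in>S. v j \<le> v k}. a k)))"
    proof (intro sum_mono mult_left_mono)
      fix j assume "j \<in> S"
      show "exp (- (\<Sum>k\<in>{k\<in>insert x S. v j \<le> v k}. a k)) \<le> exp (- (\<Sum>k\<in>{k\<in>S. v j \<le> v k}. a k))"
        using insert.hyps pos by (simp, intro sum_mono2) auto
      show "0 \<le> a j" using pos \<open>j \<in> S\<close> by simp
    qed
    also have "\<dots> \<le> 1 - exp (- sum a S)"
      using insert.IH pos by simp
    also have "a x * exp (- sum a (insert x S)) + (1 - exp (- sum a S))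
        = 1 - (exp (a x) - a x) * exp (- sum a (insert x S))"
      using insert.hyps False by (simp add: algebra_simps flip: exp_add)
    also have "\<dots> \<le> 1 - 1 * exp (- sum a (insert x S))"
      using exp_ge_add_one_self[of "a x"]
      by (intro diff_left_mono mult_right_mono) (simp_all add: algebra_simps)
    finally show ?thesis by simp
  qed
qed

text \<open>\<open>kern z w = 1 - \<rho>(z, w)^2\<close> for the pseudohyperbolic distance \<open>\<rho>\<close>.\<close>

definition kern :: "complex \<Rightarrow> complex \<Rightarrow> real" where
  "kern z w = (1 - (norm z)\<^sup>2) * (1 - (norm w)\<^sup>2) / (norm (1 - cnj w * z))\<^sup>2"

lemma norm_1_minus_cnj_mult_sq:
  "(norm (1 - cnj w * z))\<^sup>2 = (norm (z - w))\<^sup>2 + (1 - (norm z)\<^sup>2) * (1 - (norm w)\<^sup>2)"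
  unfolding cmod_power2 by (simp add: power2_eq_square algebra_simps)

lemma one_minus_cnj_mult_nonzero:
  assumes "norm z < 1" "norm w < 1"
  shows "1 - cnj w * z \<noteq> 0"
proof
  assume "1 - cnj w * z = 0"
  hence "norm w * norm z = 1"
    by (metis complex_mod_cnj norm_mult norm_one right_minus_eq)
  moreover have "norm w * norm z < 1"
    using assms by (metis mult_strict_mono' norm_ge_zero mult_1)
  ultimately show False by simp
qed

lemma kern_eq:
  assumes "norm z < 1" "norm w < 1"
  shows "(norm ((z - w) / (1 - cnj w * z)))\<^sup>2 = 1 - kern z w"
  using one_minus_cnj_mult_nonzero[OF assms] norm_1_minus_cnj_mult_sq[of w z]
  by (simp add: kern_def norm_divide power_divide field_simps)

lemma kern_nonneg:
  assumes "norm z < 1" "norm w < 1"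
  shows "0 \<le> kern z w"
  using assms by (auto simp: kern_def abs_square_less_1 intro!: divide_nonneg_nonneg mult_nonneg_nonneg
     power_le_one)

lemma kern_commute: "kern z w = kern w z"
proof -
  have "norm (1 - cnj w * z) = norm (1 - cnj z * w)"
    by (subst complex_mod_cnj[symmetric]) (simp add: mult.commute)
  thus ?thesis by (simp add: kern_def mult.commute)
qed

text \<open>The real part of the Herglotz kernel is the Poisson kernel. It supplies the holomorphic
  exponent in the interpolation formula and reduces kernel sums over rotations to sums of 1 / (1 -
  u).\<close>

lemma Re_herglotz:
  assumes "u \<noteq> 1"
  shows "Re ((1 + u) / (1 - u)) = (1 - (norm u)\<^sup>2) / (norm (1 - u))\<^sup>2"
  unfolding Re_divide cmod_power2 by (simp add: power2_eq_square algebra_simps)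

text \<open>For t between 0 and 1/2, ln (1 - t) is at least -t - 2 t^2, hence at least -2 t. With t
  = 1 - rho^2 this turns a Carleson bound into a lower bound for Blaschke products.\<close>

lemma prod_ge_exp_neg:
  fixes t :: "'a \<Rightarrow> real"
  assumes "finite F" "\<And>k. k \<in> F \<Longrightarrow> 0 \<le> t k \<and> t k \<le> 1 / 2"
  shows "exp (- 2 * sum t F) \<le> (\<Prod>k\<in>F. 1 - t k)"
proof -
  have "exp (- 2 * t k) \<le> 1 - t k" if "k \<in> F" for k
  proof -
    have "- t k - 2 * (t k)\<^sup>2 \<le> ln (1 - t k)"
      using assms(2)[OF that] by (intro ln_one_minus_pos_lower_bound) auto
    moreover have "2 * (t k)\<^sup>2 \<le> t k"
      using mult_right_mono[of "2 * t k" 1 "t k"] assms(2)[OF that] by (simp add: power2_eq_square)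
    ultimately have "- 2 * t k \<le> ln (1 - t k)" by simp
    thus ?thesis using assms(2)[OF that] by (simp add: ln_ge_iff)
  qed
  hence "(\<Prod>k\<in>F. exp (- 2 * t k)) \<le> (\<Prod>k\<in>F. 1 - t k)"
    by (intro prod_mono) auto
  thus ?thesis using assms(1) by (simp add: exp_sum sum_distrib_left)
qed

text \<open>By \<open>Re_herglotz\<close> the claim reduces to 1 - |w|^2 <= 1 - |w|^2 |x|^2. It
  makes the exponential factor small enough to control the squared kernels at every point of the
  disc.\<close>

lemma herglotz_lower:
  assumes "norm x < 1" "norm w < 1"
  shows "((1 - (norm w)\<^sup>2) / norm (1 - cnj w * x))\<^sup>2
    \<le> (1 - (norm w)\<^sup>2) * Re ((1 + cnj w * x) / (1 - cnj w * x))"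
proof -
  have ne: "cnj w * x \<noteq> 1" using one_minus_cnj_mult_nonzero[OF assms] by auto
  have "(norm w)\<^sup>2 \<le> 1" "(norm x)\<^sup>2 \<le> 1" using assms by (auto simp: power_le_one)
  hence "(norm w)\<^sup>2 * (norm x)\<^sup>2 \<le> (norm w)\<^sup>2" by (simp add: mult_left_le)
  hence "(1 - (norm w)\<^sup>2) * (1 - (norm w)\<^sup>2) / (norm (1 - cnj w * x))\<^sup>2
    \<le> (1 - (norm w)\<^sup>2) * (1 - (norm w)\<^sup>2 * (norm x)\<^sup>2) / (norm (1 - cnj w * x))\<^sup>2"
    using \<open>(norm w)\<^sup>2 \<le> 1\<close> by (intro divide_right_mono mult_left_mono) auto
  thus ?thesis
    by (simp add: Re_herglotz[OF ne] norm_mult power_mult_distrib power_divide power2_eq_square[of "1 - _"])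
qed

text \<open>The order of the moduli enters through 1 - |w|^2 |x|^2 <= 1 - |x|^4 <= 2 (1 - |x|^2). At
  a node this bounds the normalisation of the exponential factor by the Carleson constant.\<close>

lemma herglotz_upper:
  assumes "norm x \<le> norm w" "norm w < 1"
  shows "(1 - (norm w)\<^sup>2) * Re ((1 + cnj w * x) / (1 - cnj w * x)) \<le> 2 * kern x w"
proof -
  have x: "norm x < 1" using assms by simp
  have ne: "cnj w * x \<noteq> 1" using one_minus_cnj_mult_nonzero[OF x assms(2)] by auto
  have w1: "(norm w)\<^sup>2 \<le> 1" "(norm x)\<^sup>2 \<le> 1" using assms x by (auto simp: power_le_one)
  have "(norm x)\<^sup>2 * (norm x)\<^sup>2 \<le> (norm w)\<^sup>2 * (norm x)\<^sup>2"
    using assms by (intro mult_right_mono power_mono) auto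
  moreover have "0 \<le> (1 - (norm x)\<^sup>2) * (1 - (norm x)\<^sup>2)" by simp
  ultimately have "1 - (norm w)\<^sup>2 * (norm x)\<^sup>2 \<le> 2 * (1 - (norm x)\<^sup>2)"
    by (simp add: algebra_simps)
  hence "(1 - (norm w)\<^sup>2) * (1 - (norm w)\<^sup>2 * (norm x)\<^sup>2) / (norm (1 - cnj w * x))\<^sup>2
     \<le> (1 - (norm w)\<^sup>2) * (2 * (1 - (norm x)\<^sup>2)) / (norm (1 - cnj w * x))\<^sup>2"
    using w1 by (intro divide_right_mono mult_left_mono) auto
  thus ?thesis
    unfolding Re_herglotz[OF ne] by (simp add: norm_mult power_mult_distrib kern_def algebra_simps)
qed

text \<open>P. Jones's explicit interpolation formula: the exponential factor turns the sum of the
  kernels into a telescoping one, so that the bound does not depend on the number of points.\<close>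

lemma finite_interpolation:
  fixes z w :: "nat \<Rightarrow> complex"
  assumes z: "\<And>j. norm (z j) < 1"
    and carleson: "\<And>F j. finite F \<Longrightarrow> (\<Sum>k\<in>F. kern (z j) (z k)) \<le> A"
    and separated: "\<And>j k. j \<noteq> k \<Longrightarrow> kern (z j) (z k) \<le> 1 / 2"
    and F: "finite F"
    and w: "\<And>j. norm (w j) \<le> B"
  shows "\<exists>\<phi>. \<phi> holomorphic_on ball 0 1 \<and> (\<forall>j\<in>F. \<phi> (z j) = w j) \<and>
           (\<forall>x\<in>ball 0 1. norm (\<phi> x) \<le> B * exp (3 * A))"
proof -
  define bl where "bl k x = (x - z k) / (1 - cnj (z k) * x)" for k x
  \<comment> \<open>Only nodes at least as close to the unit circle as \<open>z j\<close> enter the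
    exponent: \<open>herglotz_upper\<close> requires it, and it is the ordering used in
    \<open>sum_mult_exp_neg_tail_le_1\<close>.\<close>
  define G where "G j = {k\<in>F. norm (z j) \<le> norm (z k)}" for j
  define H where "H k x = (1 - (norm (z k))\<^sup>2) *\<^sub>R ((1 + cnj (z k) * x) / (1 - cnj (z k) * x))" for k x
  \<comment> \<open>The Blaschke quotient vanishes at the other nodes, the squared kernel supplies
    the weight \<open>a x j\<close>, and the exponential makes the sum over \<open>j\<close>
    bounded; each factor is 1 at \<open>z j\<close>.\<close>
  define f where "f j x = (\<Prod>k\<in>F - {j}. bl k x / bl k (z j)) *
     (of_real (1 - (norm (z j))\<^sup>2) / (1 - cnj (z j) * x))\<^sup>2 *
     exp (- (\<Sum>k\<in>G j. H k x - H k (z j)))" for j x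
  define a where "a x k = ((1 - (norm (z k))\<^sup>2) / norm (1 - cnj (z k) * x))\<^sup>2" for x k
  have nz: "1 - cnj (z k) * x \<noteq> 0" if "norm x < 1" for k x
    using one_minus_cnj_mult_nonzero[OF that z] .
  have sq1: "(norm (z j))\<^sup>2 < 1" for j
    using z[of j] by (simp add: abs_square_less_1)
  have B: "0 \<le> B" using w[of 0] norm_ge_zero order_trans by blast
  have holo: "f j holomorphic_on ball 0 1" for j
    unfolding f_def bl_def H_def scaleR_conv_of_real by (intro holomorphic_intros) (use nz in auto)
  have bl_sq: "(norm (bl k x))\<^sup>2 = 1 - kern x (z k)" if "norm x < 1" for k x
    unfolding bl_def using kern_eq[OF that z] .
  have bl_ne: "bl k (z j) \<noteq> 0" if "j \<noteq> k" for j k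
    using bl_sq[OF z, of k j] separated[OF that] by auto
  have bl_le: "norm (bl k x) \<le> 1" if "norm x < 1" for k x
  proof -
    have "(norm (bl k x))\<^sup>2 \<le> 1\<^sup>2" using bl_sq[OF that, of k] kern_nonneg[OF that z, of k] by simp
    thus ?thesis by (rule power2_le_imp_le) simp
  qed
  have prod_lower: "exp (- A) \<le> norm (\<Prod>k\<in>F - {j}. bl k (z j))" for j
  proof -
    have "(exp (- A))\<^sup>2 = exp (- 2 * A)" by (simp flip: exp_double)
    also have "\<dots> \<le> exp (- 2 * (\<Sum>k\<in>F - {j}. kern (z j) (z k)))"
      using carleson[of "F - {j}" j] F by simp
    also have "\<dots> \<le> (\<Prod>k\<in>F - {j}. 1 - kern (z j) (z k))"
      using F separated kern_nonneg[OF z z] by (intro prod_ge_exp_neg) auto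
    also have "\<dots> = (norm (\<Prod>k\<in>F - {j}. bl k (z j)))\<^sup>2"
      by (simp add: bl_sq[OF z] prod_power_distrib flip: prod_norm)
    finally show ?thesis by (rule power2_le_imp_le) simp
  qed
  have f_self: "f j (z j) = 1" for j
  proof -
    have "of_real (1 - (norm (z j))\<^sup>2) = 1 - cnj (z j) * z j"
      by (simp add: complex_norm_square mult.commute del: of_real_power)
    hence "(of_real (1 - (norm (z j))\<^sup>2) / (1 - cnj (z j) * z j))\<^sup>2 = 1"
      using nz[OF z, of j j] by simp
    moreover have "(\<Prod>k\<in>F - {j}. bl k (z j) / bl k (z j)) = 1"
      using bl_ne by (intro prod.neutral) auto
    ultimately show ?thesis by (simp only: f_def) simp
  qed
  have f_other: "f j (z i) = 0" if "i \<in> F" "i \<noteq> j" for i j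
  proof -
    have "(\<Prod>k\<in>F - {j}. bl k (z i) / bl k (z j)) = 0"
      using that F by (intro prod_zero) (auto simp: bl_def)
    thus ?thesis by (simp add: f_def)
  qed
  \<comment> \<open>One factor \<open>exp A\<close> comes from dividing by the Blaschke product at
    \<open>z j\<close>, the other \<open>exp (2 * A)\<close> from the real parts of
    \<open>H k (z j)\<close>.\<close>
  have bound: "norm (f j x) \<le> exp (3 * A) * (a x j * exp (- (\<Sum>k\<in>G j. a x k)))"
    if x: "norm x < 1" and "j \<in> F" for j x
  proof -
    have "norm (\<Prod>k\<in>F - {j}. bl k x / bl k (z j)) = (\<Prod>k\<in>F - {j}. norm (bl k x)) / norm (\<Prod>k\<in>F - {j}. bl k (z j))"
      by (simp add: prod_dividef norm_divide prod_norm)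
    also have "\<dots> \<le> 1 / exp (- A)"
      using prod_lower[of j] bl_le[OF x] by (intro frac_le) (auto intro: prod_le_1)
    finally have 1: "norm (\<Prod>k\<in>F - {j}. bl k x / bl k (z j)) \<le> exp A"
      by (simp add: exp_minus field_simps)
    have 2: "norm ((of_real (1 - (norm (z j))\<^sup>2) / (1 - cnj (z j) * x))\<^sup>2) = a x j"
      using sq1[of j] by (simp only: norm_power norm_divide a_def norm_of_real abs_of_pos diff_gt_0_iff_gt)
    have "(\<Sum>k\<in>G j. a x k) \<le> (\<Sum>k\<in>G j. Re (H k x))"
      unfolding a_def H_def using herglotz_lower[OF x z] by (intro sum_mono) simp
    moreover have "(\<Sum>k\<in>G j. Re (H k (z j))) \<le> (\<Sum>k\<in>G j. 2 * kern (z j) (z k))"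
      unfolding H_def using herglotz_upper[OF _ z] by (intro sum_mono) (simp add: G_def)
    moreover have "(\<Sum>k\<in>G j. 2 * kern (z j) (z k)) \<le> 2 * A"
      using carleson[of "G j" j] F by (simp add: G_def flip: sum_distrib_left)
    ultimately have "norm (exp (- (\<Sum>k\<in>G j. H k x - H k (z j)))) \<le> exp (2 * A - (\<Sum>k\<in>G j. a x k))"
      by (simp add: sum_subtractf)
    hence "norm (f j x) \<le> exp A * a x j * exp (2 * A - (\<Sum>k\<in>G j. a x k))"
      unfolding f_def norm_mult using 1 2
      by (intro mult_mono) (auto simp: a_def)
    also have "\<dots> = (exp A * exp (2 * A)) * (a x j * exp (- (\<Sum>k\<in>G j. a x k)))"
      by (simp add: exp_diff exp_minus field_simps)
    also have "exp A * exp (2 * A) = exp (3 * A)"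
      by (simp flip: exp_add)
    finally show ?thesis .
  qed
  define \<phi> where "\<phi> x = (\<Sum>j\<in>F. w j * f j x)" for x
  have "\<phi> holomorphic_on ball 0 1"
    unfolding \<phi>_def by (intro holomorphic_intros holo)
  moreover have "\<phi> (z i) = w i" if "i \<in> F" for i
  proof -
    have "\<phi> (z i) = (\<Sum>j\<in>F. if j = i then w j else 0)"
      unfolding \<phi>_def using f_self f_other that by (intro sum.cong) auto
    thus ?thesis using F that by simp
  qed
  moreover have "norm (\<phi> x) \<le> B * exp (3 * A)" if "x \<in> ball 0 1" for x
  proof -
    have x: "norm x < 1" using that by simp
    have "norm (\<phi> x) \<le> (\<Sum>j\<in>F. norm (w j * f j x))"
      unfolding \<phi>_def by (rule norm_sum)
    also have "\<dots> \<le> (\<Sum>j\<in>F. B * (exp (3 * A) * (a x j * exp (- (\<Sum>k\<in>G j. a x k)))))"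
      unfolding norm_mult by (intro sum_mono mult_mono w bound x B) auto
    also have "\<dots> = B * exp (3 * A) * (\<Sum>j\<in>F. a x j * exp (- (\<Sum>k\<in>G j. a x k)))"
      by (simp add: sum_distrib_left mult.assoc)
    also have "(\<Sum>j\<in>F. a x j * exp (- (\<Sum>k\<in>G j. a x k))) \<le> 1 - exp (- sum (a x) F)"
      unfolding G_def by (rule sum_mult_exp_neg_tail_le_1[OF F]) (simp add: a_def)
    also have "\<dots> \<le> 1" by simp
    finally show ?thesis using B by (simp add: mult_left_mono)
  qed
  ultimately show ?thesis by blast
qed

text \<open>The bound in \<open>finite_interpolation\<close> does not depend on the number of nodes,
  so Montel's theorem yields a limit of the interpolants for the first \<open>N\<close> nodes. This
  is the sufficiency half of Carleson's theorem, for separation rho^2 >= 1/2.\<close>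

lemma interpolating_if_kern_sums_bounded:
  fixes z :: "nat \<Rightarrow> complex"
  assumes z: "\<And>j. norm (z j) < 1"
    and carleson: "\<And>F j. finite F \<Longrightarrow> (\<Sum>k\<in>F. kern (z j) (z k)) \<le> A"
    and separated: "\<And>j k. j \<noteq> k \<Longrightarrow> kern (z j) (z k) \<le> 1 / 2"
  shows "interpolating z"
  unfolding interpolating_def
proof (intro conjI allI impI)
  show "z n \<in> ball 0 1" for n using z by simp
next
  fix w :: "nat \<Rightarrow> complex"
  assume "bounded (range w)"
  then obtain B where w: "\<And>n. norm (w n) \<le> B"
    by (auto simp: bounded_iff)
  have "\<exists>\<phi>. \<phi> holomorphic_on ball 0 1 \<and> (\<forall>j\<in>{..<N}. \<phi> (z j) = w j) \<and>
           (\<forall>x\<in>ball 0 1. norm (\<phi> x) \<le> B * exp (3 * A))" for N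
    by (rule finite_interpolation[OF z carleson separated finite_lessThan w])
  then obtain \<Phi> where "\<And>N. \<Phi> N holomorphic_on ball 0 1 \<and> (\<forall>j\<in>{..<N}. \<Phi> N (z j) = w j) \<and>
           (\<forall>x\<in>ball 0 1. norm (\<Phi> N x) \<le> B * exp (3 * A))"
    by metis
  hence \<Phi>: "\<And>N. \<Phi> N holomorphic_on ball 0 1"
      "\<And>N j. j < N \<Longrightarrow> \<Phi> N (z j) = w j"
      "\<And>N x. x \<in> ball 0 1 \<Longrightarrow> norm (\<Phi> N x) \<le> B * exp (3 * A)"
    by auto
  obtain g r where g: "g holomorphic_on ball 0 1" "strict_mono (r :: nat \<Rightarrow> nat)"
      and lim: "\<And>x. x \<in> ball 0 1 \<Longrightarrow> (\<lambda>n. \<Phi> (r n) x) \<longlonglongrightarrow> g x"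
  proof (rule Montel[of "ball 0 1" "range \<Phi>" \<Phi>])
    show "\<exists>B. \<forall>h\<in>range \<Phi>. \<forall>x\<in>K. norm (h x) \<le> B" if "K \<subseteq> ball 0 1" for K
      using that \<Phi>(3) by blast
  qed (use \<Phi>(1) in auto)
  have "norm (g x) \<le> B * exp (3 * A)" if "x \<in> ball 0 1" for x
    using Lim_bounded[OF tendsto_norm[OF lim[OF that]]] \<Phi>(3)[OF that] by blast
  hence "bounded (g ` ball 0 1)" unfolding bounded_iff by blast
  moreover have "g (z n) = w n" for n
  proof (rule LIMSEQ_unique)
    show "(\<lambda>i. \<Phi> (r i) (z n)) \<longlonglongrightarrow> g (z n)" using z by (intro lim) simp
    have "\<forall>\<^sub>F i in sequentially. n < r i"
      by (rule eventually_compose_filterlim[OF eventually_gt_at_top filterlim_subseq[OF g(2)]])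
    hence "\<forall>\<^sub>F i in sequentially. \<Phi> (r i) (z n) = w n"
      by eventually_elim (rule \<Phi>(2))
    thus "(\<lambda>i. \<Phi> (r i) (z n)) \<longlonglongrightarrow> w n" by (rule tendsto_eventually)
  qed
  ultimately show "\<exists>\<phi>. \<phi> holomorphic_on ball 0 1 \<and> bounded (\<phi> ` ball 0 1) \<and> (\<forall>n. \<phi> (z n) = w n)"
    using g(1) by blast
qed

section \<open>Rotation-invariant point sets\<close>

text \<open>The Poisson kernel summed over all rotations by \<open>M\<close>-th roots of unity, computed with
  \<open>1 / (1 - u) = (\<Sum>n<M. u^n) / (1 - u^M)\<close>, where \<open>u^M\<close> does not depend on the rotation.\<close>

lemma sum_inverse_norm_sq_roots_unity_le:
  fixes \<zeta> :: complex and M :: nat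
  assumes "norm \<zeta> < 1" "M > 0"
  shows "(\<Sum>h<M. 1 / (norm (1 - \<zeta> * cis (2 * pi * h / M)))\<^sup>2)
     \<le> 2 * M / ((1 - norm \<zeta> ^ M) * (1 - (norm \<zeta>)\<^sup>2))"
proof -
  define u where "u h = \<zeta> * cis (2 * pi * h / M)" for h :: nat
  have norm_u: "norm (u h) = norm \<zeta>" for h by (simp add: u_def norm_mult)
  have u1: "u h \<noteq> 1" for h using norm_u[of h] assms(1) by auto
  have uM: "u h ^ M = \<zeta> ^ M" for h
  proof -
    have "cis (2 * pi * h / M) ^ M = cis (2 * pi * h)"
      using assms(2) by (simp add: Complex.DeMoivre)
    also have "\<dots> = 1" by (metis cis_multiple_2pi Ints_of_nat)
    finally show ?thesis by (simp add: u_def power_mult_distrib)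
  qed
  have tM: "norm \<zeta> ^ M < 1" using assms by (simp add: power_less_one_iff)
  hence \<zeta>M: "\<zeta> ^ M \<noteq> 1" by (metis norm_power norm_one less_irrefl)
  \<comment> \<open>Orthogonality of characters: only the term \<open>n = 0\<close> survives the
    average over rotations.\<close>
  have roots: "(\<Sum>h<M. cis (2 * pi * h / M) ^ n) = (if n = 0 then of_nat M else 0)" if "n < M" for n
  proof (cases "n = 0")
    case False
    have c: "cis (2 * pi * h / M) ^ n = cis (2 * pi * n / M) ^ h" for h
      unfolding Complex.DeMoivre by (simp add: mult_ac)
    have "cis (2 * pi * n / M) = exp (2 * of_real pi * \<i> * of_nat n / of_nat M)"
      by (simp add: cis_conv_exp mult_ac)
    hence ne: "cis (2 * pi * n / M) \<noteq> 1"
      using complex_root_unity_eq_1[of M n] assms(2) that False by (auto dest: dvd_imp_le)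
    have "cis (2 * pi * n / M) ^ M = cis (2 * pi * n)"
      using assms(2) by (simp add: Complex.DeMoivre)
    also have "\<dots> = 1" by (metis cis_multiple_2pi Ints_of_nat)
    finally have "(\<Sum>h<M. cis (2 * pi * n / M) ^ h) = 0"
      using geometric_sum[OF ne, of M] by simp
    thus ?thesis using False by (simp add: c)
  qed simp
  have "(\<Sum>h<M. 1 / (1 - u h)) = (\<Sum>h<M. (\<Sum>n<M. u h ^ n) / (1 - \<zeta> ^ M))"
  proof (rule sum.cong)
    fix h
    have "1 - \<zeta> ^ M = (1 - u h) * (\<Sum>n<M. u h ^ n)"
      by (subst one_diff_power_eq[symmetric]) (simp add: uM)
    thus "1 / (1 - u h) = (\<Sum>n<M. u h ^ n) / (1 - \<zeta> ^ M)"
      using \<zeta>M u1[of h] by (simp add: field_simps)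
  qed simp
  also have "\<dots> = (\<Sum>n<M. \<zeta> ^ n * (\<Sum>h<M. cis (2 * pi * h / M) ^ n)) / (1 - \<zeta> ^ M)"
    by (subst sum_divide_distrib[symmetric], subst sum.swap)
       (simp add: u_def power_mult_distrib sum_distrib_left)
  also have "(\<Sum>n<M. \<zeta> ^ n * (\<Sum>h<M. cis (2 * pi * h / M) ^ n)) = (\<Sum>n<M. if n = 0 then of_nat M else 0)"
    by (intro sum.cong) (auto simp: roots)
  also have "\<dots> = of_nat M" using assms(2) by simp
  finally have sum1: "(\<Sum>h<M. 1 / (1 - u h)) = of_nat M / (1 - \<zeta> ^ M)" .
  have "(\<Sum>h<M. (1 - (norm \<zeta>)\<^sup>2) / (norm (1 - u h))\<^sup>2) = (\<Sum>h<M. Re ((1 + u h) / (1 - u h)))"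
    by (simp add: Re_herglotz[OF u1] norm_u)
  also have "\<dots> = (\<Sum>h<M. Re (2 * (1 / (1 - u h)) - 1))"
  proof (intro sum.cong refl)
    fix h show "Re ((1 + u h) / (1 - u h)) = Re (2 * (1 / (1 - u h)) - 1)"
      using u1[of h] by (intro arg_cong[where f = Re]) (simp add: field_simps)
  qed
  also have "\<dots> = Re (2 * (\<Sum>h<M. 1 / (1 - u h)) - of_nat M)"
    by (simp add: sum_subtractf sum_distrib_left)
  also have "\<dots> \<le> norm (2 * (\<Sum>h<M. 1 / (1 - u h)))"
    using complex_Re_le_cmod[of "2 * (\<Sum>h<M. 1 / (1 - u h))"] by simp
  also have "\<dots> = 2 * M / norm (1 - \<zeta> ^ M)"
    unfolding sum1 by (simp add: norm_mult norm_divide)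
  also have "\<dots> \<le> 2 * M / (1 - norm \<zeta> ^ M)"
    using norm_triangle_ineq2[of 1 "\<zeta> ^ M"] tM \<zeta>M by (intro divide_left_mono mult_pos_pos) (auto simp: norm_power)
  finally have "(1 - (norm \<zeta>)\<^sup>2) * (\<Sum>h<M. 1 / (norm (1 - u h))\<^sup>2) \<le> 2 * M / (1 - norm \<zeta> ^ M)"
    by (simp add: sum_distrib_left)
  moreover have "(norm \<zeta>)\<^sup>2 < 1" using assms(1) by (simp add: abs_square_less_1)
  ultimately have "(\<Sum>h<M. 1 / (norm (1 - u h))\<^sup>2) \<le> 2 * M / (1 - norm \<zeta> ^ M) / (1 - (norm \<zeta>)\<^sup>2)"
    by (subst pos_le_divide_eq) (auto simp: mult.commute)
  thus ?thesis by (simp add: u_def)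
qed

lemma power_one_minus_inverse_le_half:
  fixes t :: real and M :: nat
  assumes "0 \<le> t" "t \<le> 1 - 1 / M" "M > 0"
  shows "t ^ M \<le> 1 / 2"
proof -
  have "t \<le> exp (- 1 / M)" using exp_ge_add_one_self[of "- 1 / M"] assms by simp
  hence "t ^ M \<le> exp (- 1 / M) ^ M" using assms by (intro power_mono) auto
  also have "\<dots> = exp (- 1)" using assms by (simp flip: exp_of_nat_mult)
  also have "\<dots> \<le> 1 / 2" using exp_ge_add_one_self[of 1] by (simp add: exp_minus field_simps)
  finally show ?thesis .
qed

text \<open>The condition on |z| |w| makes (|z| |w|)^M at most 1/2, so the rotations are fine enough
  for their sum to act like a circle average. Both bounds follow because (1 - |z|^2) (1 - |w|^2) /
  (1 - |z|^2 |w|^2) is at most either factor of its numerator.\<close>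

lemma sum_kern_rotations_le:
  fixes z w :: complex and M :: nat
  assumes z: "norm z < 1" and w: "norm w < 1" and "M > 0" and zw: "norm z * norm w \<le> 1 - 1 / M"
  shows "(\<Sum>h<M. kern z (w * cis (2 * pi * real h / M))) \<le> 4 * M * (1 - (norm z)\<^sup>2)"
    and "(\<Sum>h<M. kern z (w * cis (2 * pi * h / M))) \<le> 4 * M * (1 - (norm w)\<^sup>2)"
proof -
  define t where "t = norm z * norm w"
  have z2: "(norm z)\<^sup>2 < 1" "(norm w)\<^sup>2 < 1" using z w by (auto simp: abs_square_less_1)
  have t: "0 \<le> t" "t < 1"
    using assms(3) zw by (auto simp: t_def intro: le_less_trans)
  have t2: "t\<^sup>2 < 1" using t by (simp add: abs_square_less_1)
  have tM: "t ^ M \<le> 1 / 2"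
    using power_one_minus_inverse_le_half[OF t(1) _ assms(3)] zw by (simp add: t_def)
  have k: "kern z (w * cis (2 * pi * h / M)) =
     (1 - (norm z)\<^sup>2) * (1 - (norm w)\<^sup>2) * (1 / (norm (1 - (w * cnj z) * cis (2 * pi * h / M)))\<^sup>2)" for h
  proof -
    have "norm (1 - cnj (w * cis (2 * pi * h / M)) * z) = norm (1 - (w * cnj z) * cis (2 * pi * h / M))"
      by (subst complex_mod_cnj[symmetric]) (simp add: mult_ac)
    thus ?thesis by (simp add: kern_def norm_mult)
  qed
  have "(\<Sum>h<M. kern z (w * cis (2 * pi * h / M)))
    = (1 - (norm z)\<^sup>2) * (1 - (norm w)\<^sup>2) * (\<Sum>h<M. 1 / (norm (1 - (w * cnj z) * cis (2 * pi * h / M)))\<^sup>2)"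
    by (simp only: k sum_distrib_left)
  also have "\<dots> \<le> (1 - (norm z)\<^sup>2) * (1 - (norm w)\<^sup>2) * (2 * M / ((1 - t ^ M) * (1 - t\<^sup>2)))"
    using sum_inverse_norm_sq_roots_unity_le[of "w * cnj z" M] t z2 assms(3)
    by (intro mult_left_mono mult_nonneg_nonneg) (auto simp: norm_mult t_def mult.commute)
  also have "\<dots> \<le> (1 - (norm z)\<^sup>2) * (1 - (norm w)\<^sup>2) * (2 * M / ((1 / 2) * (1 - t\<^sup>2)))"
    using tM t2 z2 by (intro mult_left_mono divide_left_mono mult_right_mono) auto
  finally have *: "(\<Sum>h<M. kern z (w * cis (2 * pi * h / M)))
     \<le> 4 * M * ((1 - (norm z)\<^sup>2) * (1 - (norm w)\<^sup>2) / (1 - t\<^sup>2))"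
    by (simp add: field_simps)
  have "t\<^sup>2 \<le> (norm z)\<^sup>2" "t\<^sup>2 \<le> (norm w)\<^sup>2"
    using z w by (auto simp: t_def power_mult_distrib mult_left_le mult_left_le_one_le power_le_one)
  hence "(1 - (norm z)\<^sup>2) * (1 - (norm w)\<^sup>2) \<le> (1 - (norm z)\<^sup>2) * (1 - t\<^sup>2)"
        "(1 - (norm z)\<^sup>2) * (1 - (norm w)\<^sup>2) \<le> (1 - t\<^sup>2) * (1 - (norm w)\<^sup>2)"
    using z2 by (auto intro!: mult_left_mono mult_right_mono)
  hence "(1 - (norm z)\<^sup>2) * (1 - (norm w)\<^sup>2) / (1 - t\<^sup>2) \<le> 1 - (norm z)\<^sup>2"
    "(1 - (norm z)\<^sup>2) * (1 - (norm w)\<^sup>2) / (1 - t\<^sup>2) \<le> 1 - (norm w)\<^sup>2"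
    using t2 by (auto simp: divide_le_eq mult.commute)
  hence "4 * M * ((1 - (norm z)\<^sup>2) * (1 - (norm w)\<^sup>2) / (1 - t\<^sup>2)) \<le> 4 * M * (1 - (norm z)\<^sup>2)"
    "4 * M * ((1 - (norm z)\<^sup>2) * (1 - (norm w)\<^sup>2) / (1 - t\<^sup>2)) \<le> 4 * M * (1 - (norm w)\<^sup>2)"
    by (intro mult_left_mono; simp)+
  with * show "(\<Sum>h<M. kern z (w * cis (2 * pi * h / M))) \<le> 4 * M * (1 - (norm z)\<^sup>2)"
    and "(\<Sum>h<M. kern z (w * cis (2 * pi * h / M))) \<le> 4 * M * (1 - (norm w)\<^sup>2)"
    by linarith+
qed

text \<open>A chord bound without trigonometry: the powers of \<open>\<omega>\<close> sum to 0, so M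
  is the sum of the 1 - \<open>\<omega>\<close>^n, and each of these has norm at most n times that
  of 1 - \<open>\<omega>\<close>.\<close>

lemma norm_one_minus_root_unity_ge:
  fixes \<omega> :: complex
  assumes "\<omega> ^ M = 1" "\<omega> \<noteq> 1" "norm \<omega> = 1" "M > 0"
  shows "2 \<le> norm (1 - \<omega>) * (real M - 1)"
proof -
  have "(\<Sum>n<M. \<omega> ^ n) = 0" using geometric_sum[OF assms(2), of M] assms(1) by simp
  hence "of_nat M = (\<Sum>n<M. 1 - \<omega> ^ n)" by (simp add: sum_subtractf)
  hence "real M = norm (\<Sum>n<M. 1 - \<omega> ^ n)" by (metis norm_of_nat)
  also have "\<dots> \<le> (\<Sum>n<M. norm (1 - \<omega> ^ n))" by (rule norm_sum)
  also have "\<dots> \<le> (\<Sum>n<M. real n * norm (1 - \<omega>))"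
  proof (intro sum_mono)
    fix n show "norm (1 - \<omega> ^ n) \<le> real n * norm (1 - \<omega>)"
      using norm_power_diff[of 1 \<omega> n] assms(3) by simp
  qed
  also have "\<dots> = norm (1 - \<omega>) * (\<Sum>n<M. real n)" by (subst mult.commute) (simp add: sum_distrib_right)
  also have "(\<Sum>n<M. real n) = real M * (real M - 1) / 2"
    by (induction M) (auto simp: field_simps)
  finally have "real M * 2 \<le> real M * (norm (1 - \<omega>) * (real M - 1))" by (simp add: mult_ac)
  thus ?thesis using assms(4) by (simp only: mult_le_cancel_left_pos of_nat_0_less_iff)
qed

text \<open>With r = 1 - 1/M the chord is at least 2 r / (M - 1) = 2 / M, while 1 - r^2 = (1 + r) /
  M is smaller. Hence the denominator of the kernel is at least twice its numerator.\<close>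

lemma kern_same_circle_le_half:
  fixes z \<omega> :: complex
  assumes \<omega>: "\<omega> ^ M = 1" "\<omega> \<noteq> 1" "norm \<omega> = 1" and M: "M > 1" and z: "norm z = 1 - 1 / M"
  shows "kern z (z * \<omega>) \<le> 1 / 2"
proof -
  define r where "r = norm z"
  have r: "0 < r" "r < 1" "r * M = real M - 1"
    using M by (simp_all add: r_def z left_diff_distrib)
  have "2 * r \<le> norm (1 - \<omega>) * (real M - 1) * r"
    using norm_one_minus_root_unity_ge[OF \<omega>] M r by (intro mult_right_mono) auto
  also have "\<dots> = r * norm (1 - \<omega>) * (real M * r)" using r(3) by (simp add: mult_ac)
  finally have "2 \<le> r * norm (1 - \<omega>) * M" using r(1) by (simp add: mult_ac)
  moreover have "(1 - r\<^sup>2) * M = 1 + r"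
  proof -
    have "(1 - r\<^sup>2) * M = (1 + r) * (M - r * M)" by (simp add: power2_eq_square algebra_simps)
    thus ?thesis using r(3) by simp
  qed
  ultimately have "(1 - r\<^sup>2) * M \<le> r * norm (1 - \<omega>) * M" using r by simp
  hence "1 - r\<^sup>2 \<le> norm (z - z * \<omega>)"
    using M by (simp add: r_def right_diff_distrib flip: norm_mult)
  moreover have r2: "0 < 1 - r\<^sup>2" using r by (simp add: abs_square_less_1)
  ultimately have "(1 - r\<^sup>2)\<^sup>2 \<le> (norm (z - z * \<omega>))\<^sup>2" by (intro power_mono) auto
  hence "2 * (1 - r\<^sup>2)\<^sup>2 \<le> (norm (1 - cnj (z * \<omega>) * z))\<^sup>2"
    using norm_1_minus_cnj_mult_sq[of "z * \<omega>" z] \<omega>(3)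
    by (simp add: norm_mult r_def power2_eq_square)
  moreover have "0 < (1 - r\<^sup>2)\<^sup>2" using r2 by simp
  moreover have "kern z (z * \<omega>) = (1 - r\<^sup>2)\<^sup>2 / (norm (1 - cnj (z * \<omega>) * z))\<^sup>2"
    using \<omega>(3) by (simp add: kern_def norm_mult r_def power2_eq_square[of "1 - _"])
  ultimately show ?thesis by (simp add: divide_le_eq)
qed

text \<open>The denominator is at least (1 - |z|)^2 and the numerator at most 4 (1 - |z|) (1 - |w|),
  so the ratio 8 of the depths gives 1/2.\<close>

lemma kern_distant_circles_le_half:
  assumes "norm z < 1" "norm w < 1" "8 * (1 - norm w) \<le> 1 - norm z"
  shows "kern z w \<le> 1 / 2"
proof -
  define x y where "x = norm z" and "y = norm w"
  have xy: "0 \<le> x" "x < 1" "0 \<le> y" "y < 1" "8 * (1 - y) \<le> 1 - x"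
    using assms by (auto simp: x_def y_def)
  have "x * y \<le> x" using xy by (simp add: mult_left_le)
  have "1 - x \<le> norm (1 - cnj w * z)"
    using norm_triangle_ineq2[of 1 "cnj w * z"] \<open>x * y \<le> x\<close>
    by (simp add: norm_mult x_def y_def mult.commute)
  hence n: "(1 - x)\<^sup>2 \<le> (norm (1 - cnj w * z))\<^sup>2" using xy by (intro power_mono) auto
  have "(1 - x\<^sup>2) * (1 - y\<^sup>2) = (1 + x) * (1 + y) * ((1 - x) * (1 - y))"
    by (simp add: power2_eq_square algebra_simps)
  also have "\<dots> \<le> 2 * 2 * ((1 - x) * (1 - y))"
    using xy by (intro mult_right_mono mult_mono) auto
  also have "\<dots> \<le> 4 * ((1 - x) * ((1 - x) / 8))"
    using xy by (simp add: mult_left_mono)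
  also have "\<dots> = (1 - x)\<^sup>2 / 2" by (simp add: power2_eq_square)
  finally have "(1 - x\<^sup>2) * (1 - y\<^sup>2) \<le> (norm (1 - cnj w * z))\<^sup>2 / 2" using n by simp
  moreover have "0 < (norm (1 - cnj w * z))\<^sup>2"
    using one_minus_cnj_mult_nonzero[OF assms(1,2)] by simp
  ultimately show ?thesis by (simp add: kern_def x_def y_def field_simps)
qed

section \<open>Large values of lacunary cosine sums\<close>

text \<open>The real part of the first \<open>l\<close> terms of the lacunary series at the boundary
  point of angle 2 pi x / 4^l. The naturals \<open>x\<close> below 4^l are then the grid points,
  read through their base 4 digits.\<close>

definition cos_sum :: "nat \<Rightarrow> real \<Rightarrow> real" where
  "cos_sum l x = (\<Sum>n<l. cos (2 * pi * 4 ^ n * x / 4 ^ l))"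

lemma cos_2pi_add_multiple: "cos (2 * pi * real k + y) = cos y"
proof -
  have "2 * pi * real k = 2 * real k * pi" by simp
  thus ?thesis by (simp only: cos_add cos_2npi sin_2npi mult_1 mult_zero_left diff_zero)
qed

lemma sum_lessThan_add:
  fixes f :: "nat \<Rightarrow> 'a :: comm_monoid_add"
  shows "(\<Sum>n<l + m. f n) = (\<Sum>n<l. f n) + (\<Sum>n<m. f (l + n))"
  by (induction m) (simp_all add: add.assoc)

text \<open>The high digits \<open>a\<close> contribute whole turns to the last \<open>m\<close>
  frequencies and disappear there; the first \<open>l\<close> frequencies see \<open>x\<close> only
  as a shift. This is the source of independence between blocks of digits.\<close>

lemma cos_sum_add: "cos_sum (l + m) (real a * 4 ^ m + x) = cos_sum l (real a + x / 4 ^ m) + cos_sum m x"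
proof -
  have "cos_sum (l + m) (real a * 4 ^ m + x)
     = (\<Sum>n<l. cos (2 * pi * 4 ^ n * (real a * 4 ^ m + x) / 4 ^ (l + m)))
       + (\<Sum>n<m. cos (2 * pi * 4 ^ (l + n) * (real a * 4 ^ m + x) / 4 ^ (l + m)))"
    unfolding cos_sum_def by (rule sum_lessThan_add)
  also have "(\<Sum>n<l. cos (2 * pi * 4 ^ n * (real a * 4 ^ m + x) / 4 ^ (l + m))) = cos_sum l (real a + x / 4 ^ m)"
    unfolding cos_sum_def by (intro sum.cong arg_cong[where f = cos]) (auto simp: power_add field_simps)
  also have "(\<Sum>n<m. cos (2 * pi * 4 ^ (l + n) * (real a * 4 ^ m + x) / 4 ^ (l + m))) = cos_sum m x"
    unfolding cos_sum_def
  proof (intro sum.cong refl)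
    fix n
    have "2 * pi * 4 ^ (l + n) * (real a * 4 ^ m + x) / 4 ^ (l + m)
       = 2 * pi * real (4 ^ n * a) + 2 * pi * 4 ^ n * x / 4 ^ m"
      by (simp add: power_add field_simps)
    thus "cos (2 * pi * 4 ^ (l + n) * (real a * 4 ^ m + x) / 4 ^ (l + m)) = cos (2 * pi * 4 ^ n * x / 4 ^ m)"
      by (simp only: cos_2pi_add_multiple)
  qed
  finally show ?thesis .
qed

lemma sum_lessThan_mult:
  fixes f :: "nat \<Rightarrow> 'a :: comm_monoid_add"
  shows "(\<Sum>j<m * n. f j) = (\<Sum>j<n. \<Sum>a<m. f (a * n + j))"
proof -
  have "(\<Sum>j<m * n. f j) = (\<Sum>a<m. \<Sum>j<n. f (a * n + j))"
    by (induction m) (simp_all add: sum_lessThan_add add.commute[of n])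
  thus ?thesis by (subst (asm) sum.swap)
qed

text \<open>The four values are c, -s, -c, s with c^2 + s^2 = 1. Base 4 thus makes the odd moments
  of one digit vanish and its mean square independent of the remaining digits.\<close>

lemma sum_cos_quarter_turns:
  fixes g :: "real \<Rightarrow> real"
  defines "g \<equiv> \<lambda>x. cos (pi * x / 2)"
  shows "(\<Sum>a<4. g (real a + x)) = 0" "(\<Sum>a<4. (g (real a + x))\<^sup>2) = 2"
    "(\<Sum>a<4. (g (real a + x)) ^ 3) = 0" "(\<Sum>a<4. (g (real a + x)) ^ 4) \<le> 2"
proof -
  define c s where "c = cos (pi * x / 2)" and "s = sin (pi * x / 2)"
  have g: "g (real 0 + x) = c" "g (real 1 + x) = - s" "g (real 2 + x) = - c" "g (real 3 + x) = s"
  proof -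
    show "g (real 0 + x) = c" by (simp add: g_def c_def)
    have "g (real 1 + x) = cos (pi / 2 + pi * x / 2)"
      unfolding g_def by (rule arg_cong[where f = cos]) (simp add: field_simps)
    thus "g (real 1 + x) = - s" by (simp add: s_def cos_add)
    have "g (real 2 + x) = cos (pi * x / 2 + pi)"
      unfolding g_def by (rule arg_cong[where f = cos]) (simp add: field_simps)
    thus "g (real 2 + x) = - c" by (simp add: c_def)
    have "g (real 3 + x) = cos ((pi / 2 + pi * x / 2) + pi)"
      unfolding g_def by (rule arg_cong[where f = cos]) (simp add: field_simps)
    thus "g (real 3 + x) = s" by (simp only: cos_periodic_pi) (simp add: s_def cos_add)
  qed
  have eq: "(\<Sum>a<4. f (real a)) = f (real 0) + f (real 1) + f (real 2) + f (real 3)" for f :: "real \<Rightarrow> real"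
    by (simp add: eval_nat_numeral)
  have cs: "c\<^sup>2 + s\<^sup>2 = 1" by (simp add: c_def s_def)
  show "(\<Sum>a<4. g (real a + x)) = 0" unfolding eq[of "\<lambda>a. g (a + x)"] g by simp
  show "(\<Sum>a<4. (g (real a + x))\<^sup>2) = 2" unfolding eq[of "\<lambda>a. (g (a + x))\<^sup>2"] g using cs by simp
  show "(\<Sum>a<4. (g (real a + x)) ^ 3) = 0" unfolding eq[of "\<lambda>a. (g (a + x)) ^ 3"] g by simp
  have "c ^ 4 + s ^ 4 = (c\<^sup>2 + s\<^sup>2)\<^sup>2 - 2 * (c * s)\<^sup>2"
    by (simp add: power2_eq_square power4_eq_xxxx algebra_simps)
  hence "c ^ 4 + s ^ 4 \<le> 1" using cs by simp
  thus "(\<Sum>a<4. (g (real a + x)) ^ 4) \<le> 2" unfolding eq[of "\<lambda>a. (g (a + x)) ^ 4"] g by simp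
qed

text \<open>Averaging over the leading base 4 digit adds an independent increment with vanishing odd
  moments. The shift \<open>\<theta>\<close> stands for the later digits.\<close>

lemma cos_sum_moments:
  defines "X l \<theta> \<equiv> (\<lambda>j. cos_sum l (real j + \<theta>))"
  shows "(\<Sum>j<4^l. X l \<theta> j) = 0" "(\<Sum>j<4^l. (X l \<theta> j)\<^sup>2) = 4 ^ l * (l / 2)"
    "(\<Sum>j<4^l. (X l \<theta> j) ^ 3) = 0" "(\<Sum>j<4^l. (X l \<theta> j) ^ 4) \<le> 4 ^ l * (real l)\<^sup>2"
proof -
  have "(\<Sum>j<4^l. X l \<theta> j) = 0 \<and> (\<Sum>j<4^l. (X l \<theta> j)\<^sup>2) = 4 ^ l * (l / 2) \<and>
    (\<Sum>j<4^l. (X l \<theta> j) ^ 3) = 0 \<and> (\<Sum>j<4^l. (X l \<theta> j) ^ 4) \<le> 4 ^ l * (real l)\<^sup>2"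
  proof (induction l)
    case 0
    show ?case by (simp add: X_def cos_sum_def)
  next
    case (Suc l)
    define C where "C j a = cos (pi * (real a + (real j + \<theta>) / 4 ^ l) / 2)" for j a :: nat
    have C: "(\<Sum>a<4. C j a) = 0" "(\<Sum>a<4. (C j a)\<^sup>2) = 2" "(\<Sum>a<4. (C j a) ^ 3) = 0"
      "(\<Sum>a<4. (C j a) ^ 4) \<le> 2" for j
      unfolding C_def by (rule sum_cos_quarter_turns)+
    have step: "X (Suc l) \<theta> (a * 4 ^ l + j) = C j a + X l \<theta> j" for a j
    proof -
      have "X (Suc l) \<theta> (a * 4 ^ l + j) = cos_sum (1 + l) (real a * 4 ^ l + (real j + \<theta>))"
        by (simp add: X_def add.assoc)
      also have "\<dots> = cos_sum 1 (real a + (real j + \<theta>) / 4 ^ l) + X l \<theta> j"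
        unfolding cos_sum_add X_def ..
      also have "cos_sum 1 (real a + (real j + \<theta>) / 4 ^ l) = C j a"
        unfolding cos_sum_def C_def by simp
      finally show ?thesis .
    qed
    have split: "(\<Sum>j<4 ^ Suc l. f (X (Suc l) \<theta> j)) = (\<Sum>j<4^l. \<Sum>a<4. f (C j a + X l \<theta> j))" for f :: "real \<Rightarrow> real"
      using sum_lessThan_mult[of "\<lambda>j. f (X (Suc l) \<theta> j)" 4 "4 ^ l"] by (simp add: step)
    have 1: "(\<Sum>a<4. C j a + x) = 4 * x" for j x
      by (simp add: sum.distrib C)
    have 2: "(\<Sum>a<4. (C j a + x)\<^sup>2) = 4 * x\<^sup>2 + 2" for j x
    proof -
      have "(\<Sum>a<4. (C j a + x)\<^sup>2) = (\<Sum>a<4. (C j a)\<^sup>2) + 2 * x * (\<Sum>a<4. C j a) + 4 * x\<^sup>2"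
        by (simp add: power2_sum sum.distrib sum_distrib_left mult_ac)
      thus ?thesis by (simp add: C)
    qed
    have 3: "(\<Sum>a<4. (C j a + x) ^ 3) = 4 * x ^ 3 + 6 * x" for j x
    proof -
      have "(\<Sum>a<4. (C j a + x) ^ 3) = (\<Sum>a<4. (C j a) ^ 3 + 3 * x * (C j a)\<^sup>2 + 3 * x\<^sup>2 * C j a + x ^ 3)"
        by (intro sum.cong) (auto simp: power2_eq_square power3_eq_cube algebra_simps)
      also have "\<dots> = (\<Sum>a<4. (C j a) ^ 3) + 3 * x * (\<Sum>a<4. (C j a)\<^sup>2) + 3 * x\<^sup>2 * (\<Sum>a<4. C j a) + 4 * x ^ 3"
        by (simp only: sum.distrib sum_distrib_left) simp
      finally show ?thesis by (simp add: C)
    qed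
    have 4: "(\<Sum>a<4. (C j a + x) ^ 4) \<le> 4 * x ^ 4 + 12 * x\<^sup>2 + 2" for j x
    proof -
      have "(\<Sum>a<4. (C j a + x) ^ 4) = (\<Sum>a<4. (C j a) ^ 4 + 4 * x * (C j a) ^ 3 + 6 * x\<^sup>2 * (C j a)\<^sup>2 + 4 * x ^ 3 * C j a + x ^ 4)"
        by (intro sum.cong) (auto simp: power2_eq_square power3_eq_cube power4_eq_xxxx algebra_simps)
      also have "\<dots> = (\<Sum>a<4. (C j a) ^ 4) + 4 * x * (\<Sum>a<4. (C j a) ^ 3) + 6 * x\<^sup>2 * (\<Sum>a<4. (C j a)\<^sup>2)
          + 4 * x ^ 3 * (\<Sum>a<4. C j a) + 4 * x ^ 4"
        by (simp only: sum.distrib sum_distrib_left) simp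
      finally show ?thesis using C(4)[of j] by (simp add: C)
    qed
    have "(\<Sum>j<4 ^ Suc l. X (Suc l) \<theta> j) = 0"
      using split[of "\<lambda>x. x"] Suc.IH by (simp add: 1 flip: sum_distrib_left)
    moreover have "(\<Sum>j<4 ^ Suc l. (X (Suc l) \<theta> j)\<^sup>2) = 4 ^ Suc l * (Suc l / 2)"
      using split[of "\<lambda>x. x\<^sup>2"] Suc.IH by (simp add: 2 sum.distrib field_simps flip: sum_distrib_left)
    moreover have "(\<Sum>j<4 ^ Suc l. (X (Suc l) \<theta> j) ^ 3) = 0"
      using split[of "\<lambda>x. x ^ 3"] Suc.IH by (simp add: 3 sum.distrib flip: sum_distrib_left)
    moreover have "(\<Sum>j<4 ^ Suc l. (X (Suc l) \<theta> j) ^ 4) \<le> 4 ^ Suc l * (real (Suc l))\<^sup>2"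
    proof -
      have "(\<Sum>j<4 ^ Suc l. (X (Suc l) \<theta> j) ^ 4) \<le> (\<Sum>j<4^l. 4 * (X l \<theta> j) ^ 4 + 12 * (X l \<theta> j)\<^sup>2 + 2)"
        unfolding split[of "\<lambda>x. x ^ 4"] by (intro sum_mono 4)
      also have "\<dots> = 4 * (\<Sum>j<4^l. (X l \<theta> j) ^ 4) + 12 * (\<Sum>j<4^l. (X l \<theta> j)\<^sup>2) + 2 * 4 ^ l"
        by (simp add: sum.distrib flip: sum_distrib_left)
      also have "\<dots> \<le> 4 * (4 ^ l * (real l)\<^sup>2) + 12 * (4 ^ l * (l / 2)) + 2 * 4 ^ l"
        using Suc.IH by (intro add_mono mult_left_mono) auto
      also have "\<dots> = 4 ^ l * (4 * (real l)\<^sup>2 + 6 * l + 2)" by (simp add: algebra_simps)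
      also have "\<dots> \<le> 4 ^ l * (4 * (real (Suc l))\<^sup>2)"
        by (intro mult_left_mono) (auto simp: power2_eq_square algebra_simps)
      finally show ?thesis by simp
    qed
    ultimately show ?case by blast
  qed
  thus "(\<Sum>j<4^l. X l \<theta> j) = 0" "(\<Sum>j<4^l. (X l \<theta> j)\<^sup>2) = 4 ^ l * (l / 2)"
    "(\<Sum>j<4^l. (X l \<theta> j) ^ 3) = 0" "(\<Sum>j<4^l. (X l \<theta> j) ^ 4) \<le> 4 ^ l * (real l)\<^sup>2"
    by blast+
qed

text \<open>A quartic polynomial \<open>P\<close> that is positive only on the interval from \<open>sqrt l / 4\<close> to \<open>7 sqrt l\<close>
  but has positive mean by the moment identities replaces the Paley--Zygmund inequality; the
  point is that it detects large positive values rather than large absolute values.\<close>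

lemma count_cos_sum_ge:
  assumes "l > 0"
  shows "4 ^ l / 1024 \<le> (\<Sum>j<(4::nat) ^ l. of_bool (sqrt l / 4 \<le> cos_sum l (real j + \<theta>)) :: real)"
proof -
  define X where "X j = cos_sum l (real j + \<theta>)" for j :: nat
  define s where "s = sqrt l"
  define P where "P x = - ((x - s / 4) * (x + s)\<^sup>2 * (x - 7 * s))" for x
  have s: "s > 0" "s\<^sup>2 = l" "s ^ 4 = (real l)\<^sup>2"
    using assms by (auto simp: s_def power2_eq_square power4_eq_xxxx)
  have le: "P x \<le> of_bool (s / 4 \<le> x) * (3136 * s ^ 4)" for x
  proof (cases "s / 4 \<le> x")
    case False
    hence "0 \<le> (x - s / 4) * (x - 7 * s)" using s by (intro mult_nonpos_nonpos) auto
    hence "0 \<le> (x - s / 4) * (x - 7 * s) * (x + s)\<^sup>2" by (rule mult_nonneg_nonneg) simp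
    thus ?thesis using False by (simp add: P_def mult_ac)
  next
    case True
    show ?thesis
    proof (cases "x \<le> 7 * s")
      case le: True
      have "(x - s / 4) * (x + s)\<^sup>2 * (7 * s - x) \<le> (7 * s) * (8 * s)\<^sup>2 * (7 * s)"
        using le True s by (intro mult_mono power_mono) auto
      moreover have "P x = (x - s / 4) * (x + s)\<^sup>2 * (7 * s - x)"
        unfolding P_def by (metis minus_diff_eq mult_minus_right)
      ultimately show ?thesis using True by (simp add: power2_eq_square power4_eq_xxxx mult_ac)
    next
      case False
      hence "0 \<le> (x - s / 4) * (x + s)\<^sup>2 * (x - 7 * s)"
        using True by (intro mult_nonneg_nonneg) auto
      moreover have "0 \<le> 3136 * s ^ 4" using s(1) by simp
      ultimately have "P x \<le> 3136 * s ^ 4" unfolding P_def by linarith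
      thus ?thesis using True by simp
    qed
  qed
  have P: "P x = - (x ^ 4) + 21 / 4 * s * x ^ 3 + 47 / 4 * s\<^sup>2 * x\<^sup>2 + 15 / 4 * s ^ 3 * x - 7 / 4 * s ^ 4" for x
    by (simp add: P_def power2_eq_square power3_eq_cube power4_eq_xxxx field_simps)
  have "(\<Sum>j<4^l. P (X j)) = - (\<Sum>j<4^l. X j ^ 4) + 21 / 4 * s * (\<Sum>j<4^l. X j ^ 3)
      + 47 / 4 * s\<^sup>2 * (\<Sum>j<4^l. (X j)\<^sup>2) + 15 / 4 * s ^ 3 * (\<Sum>j<4^l. X j) - 7 / 4 * s ^ 4 * 4 ^ l"
    by (simp add: P sum.distrib sum_subtractf sum_negf sum_distrib_left)
  also have "\<dots> \<ge> 25 / 8 * s ^ 4 * 4 ^ l"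
  \<comment> \<open>In units of \<open>s ^ 4 * 4 ^ l\<close> the moments give at least -1 + 47/8 -
    7/4 = 25/8.\<close>
  proof -
    have "47 / 4 * s\<^sup>2 * (\<Sum>j<4^l. (X j)\<^sup>2) = 47 / 8 * s ^ 4 * 4 ^ l"
      unfolding X_def cos_sum_moments(2) s by (simp add: power2_eq_square)
    moreover have "(\<Sum>j<4^l. X j ^ 4) \<le> s ^ 4 * 4 ^ l"
      using cos_sum_moments(4)[of l \<theta>] unfolding X_def s by (simp add: mult.commute)
    moreover have "(\<Sum>j<4^l. X j) = 0" "(\<Sum>j<4^l. X j ^ 3) = 0"
      unfolding X_def by (rule cos_sum_moments)+
    ultimately show ?thesis by (simp add: mult_ac)
  qed
  also have "(\<Sum>j<4^l. P (X j)) \<le> (\<Sum>j<(4::nat)^l. of_bool (s / 4 \<le> X j) * (3136 * s ^ 4))"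
    by (intro sum_mono le)
  also have "\<dots> = (\<Sum>j<(4::nat)^l. of_bool (s / 4 \<le> X j)) * 3136 * s ^ 4"
    by (simp add: sum_distrib_right)
  finally have "s ^ 4 * (25 / 8 * 4 ^ l) \<le> s ^ 4 * (3136 * (\<Sum>j<(4::nat)^l. of_bool (s / 4 \<le> X j)))"
    by (simp add: mult_ac)
  \<comment> \<open>As \<open>P\<close> is at most 3136 = 7 * 8^2 * 7 times \<open>s ^ 4\<close>,
    the density obtained is (25/8) / 3136, slightly above 1/1024.\<close>
  hence "25 / 8 * 4 ^ l \<le> 3136 * (\<Sum>j<(4::nat)^l. of_bool (s / 4 \<le> X j) :: real)"
    using s(1) by (simp only: mult_le_cancel_left_pos zero_less_power)
  moreover have "(0::real) \<le> 4 ^ l" by simp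
  ultimately show ?thesis unfolding s_def X_def by linarith
qed

text \<open>Each new leading block of \<open>l\<close> digits is good with density 1/1024 whatever
  the later digits are, because \<open>count_cos_sum_ge\<close> holds for every shift. Since the
  good values are positive, they add up over the blocks without cancellation.\<close>

lemma count_cos_sum_ge_blocks:
  assumes "l > 0"
  shows "(4 ^ l / 1024) ^ s \<le>
    (\<Sum>j<(4::nat) ^ (s * l). of_bool (s * sqrt l / 4 \<le> cos_sum (s * l) (real j + \<theta>)) :: real)"
proof (induction s)
  case 0
  show ?case by (simp add: cos_sum_def)
next
  case (Suc s)
  define m where "m = s * l"
  define B where "B j = (of_bool (s * sqrt l / 4 \<le> cos_sum m (real j + \<theta>)) :: real)" for j :: nat
  define D where "D a j = (of_bool (sqrt l / 4 \<le> cos_sum l (real a + (real j + \<theta>) / 4 ^ m)) :: real)" for a j :: nat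
  have "(4 ^ l / 1024) ^ Suc s \<le> (4 ^ l / 1024) * (\<Sum>j<4^m. B j)"
    using Suc.IH by (simp add: B_def m_def mult_left_mono)
  also have "\<dots> = (\<Sum>j<4^m. B j * (4 ^ l / 1024))"
    by (simp add: sum_distrib_left mult_ac)
  also have "\<dots> \<le> (\<Sum>j<4^m. B j * (\<Sum>a<4^l. D a j))"
    unfolding D_def using count_cos_sum_ge[OF assms] by (intro sum_mono mult_left_mono) (auto simp: B_def)
  also have "\<dots> = (\<Sum>j<4^m. \<Sum>a<4^l. B j * D a j)"
    by (simp add: sum_distrib_left)
  also have "\<dots> \<le> (\<Sum>j<4^m. \<Sum>a<4^l.
      of_bool (Suc s * sqrt l / 4 \<le> cos_sum (l + m) (real (a * 4 ^ m + j) + \<theta>)))"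
  proof (intro sum_mono)
    fix a j :: nat
    have "cos_sum (l + m) (real (a * 4 ^ m + j) + \<theta>)
        = cos_sum l (real a + (real j + \<theta>) / 4 ^ m) + cos_sum m (real j + \<theta>)"
      using cos_sum_add[of l m a "real j + \<theta>"] by (simp add: add.assoc)
    thus "B j * D a j \<le> of_bool (Suc s * sqrt l / 4 \<le> cos_sum (l + m) (real (a * 4 ^ m + j) + \<theta>))"
      by (auto simp: B_def D_def field_simps)
  qed
  also have "\<dots> = (\<Sum>j<4 ^ (Suc s * l). of_bool (Suc s * sqrt l / 4 \<le> cos_sum (Suc s * l) (real j + \<theta>)))"
    by (subst sum_lessThan_mult[symmetric]) (simp add: m_def power_add)
  finally show ?case .
qed

lemma card_cos_sum_ge_blocks:
  assumes "l > 0"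
  shows "(4 ^ l / 1024) ^ s \<le> real (card {j. j < 4 ^ (s * l) \<and> s * sqrt l / 4 \<le> cos_sum (s * l) (real j)})"
proof -
  have "(\<Sum>j<(4::nat) ^ (s * l). of_bool (s * sqrt l / 4 \<le> cos_sum (s * l) (real j)) :: real)
     = real (card {j. j < 4 ^ (s * l) \<and> s * sqrt l / 4 \<le> cos_sum (s * l) (real j)})"
    by (subst sum_of_bool_eq) (auto simp: Int_def)
  thus ?thesis using count_cos_sum_ge_blocks[OF assms, of s 0] by simp
qed

section \<open>The lacunary Bloch function\<close>

definition lacunary :: "complex \<Rightarrow> complex" where
  "lacunary z = (\<Sum>n. z ^ 4 ^ n)"

lemma less_four_power: "n < 4 ^ n"
  by (induction n) auto

lemma summable_lacunary:
  fixes z :: complex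
  assumes "norm z < 1"
  shows "summable (\<lambda>n. norm (z ^ 4 ^ n))"
proof (rule summable_comparison_test)
  show "\<exists>N. \<forall>n\<ge>N. norm (norm (z ^ 4 ^ n)) \<le> norm z ^ n"
    using assms power_decreasing[OF less_imp_le[OF less_four_power], of "norm z"]
    by (simp add: norm_power)
  show "summable (\<lambda>n. norm z ^ n)" using assms by (simp add: summable_geometric)
qed

text \<open>The term of index n + 1 is at most twice the block of x^l with 4^n <= l < 4^(n+1): the
  block has 3 * 4^n terms, each at least x^(4^(n+1) - 1). The blocks fill up a geometric
  series.\<close>

lemma lacunary_derivative_sum_le:
  fixes x :: real
  assumes "0 \<le> x" "x < 1"
  shows "(\<Sum>n<N. 4 ^ n * x ^ (4 ^ n - 1)) \<le> 2 / (1 - x)"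
proof -
  have "(\<Sum>n\<le>N. 4 ^ n * x ^ (4 ^ n - 1)) \<le> 2 * (\<Sum>l<4^N. x ^ l)"
  proof (induction N)
    case (Suc N)
    have "4 ^ Suc N * x ^ (4 ^ Suc N - 1) \<le> 6 * 4 ^ N * x ^ (4 ^ Suc N - 1)"
      using assms by (intro mult_right_mono) auto
    also have "\<dots> = 2 * (\<Sum>l<(3::nat) * 4 ^ N. x ^ (4 ^ Suc N - 1))"
      by simp
    also have "\<dots> \<le> 2 * (\<Sum>l<(3::nat) * 4 ^ N. x ^ (4 ^ N + l))"
      using assms by (intro mult_left_mono sum_mono power_decreasing) auto
    finally have "(\<Sum>n\<le>Suc N. 4 ^ n * x ^ (4 ^ n - 1))
        \<le> 2 * ((\<Sum>l<4^N. x ^ l) + (\<Sum>l<(3::nat) * 4 ^ N. x ^ (4 ^ N + l)))"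
      using Suc.IH by simp
    also have "(\<Sum>l<4^N. x ^ l) + (\<Sum>l<(3::nat) * 4 ^ N. x ^ (4 ^ N + l)) = (\<Sum>l<4 ^ Suc N. x ^ l)"
      by (subst sum_lessThan_add[symmetric]) simp
    finally show ?case .
  qed simp
  moreover have "(\<Sum>l<4^N. x ^ l) \<le> 1 / (1 - x)"
    using assms by (simp add: sum_gp_strict divide_right_mono)
  moreover have "(\<Sum>n<N. 4 ^ n * x ^ (4 ^ n - 1)) \<le> (\<Sum>n\<le>N. 4 ^ n * x ^ (4 ^ n - 1))"
    using assms by (intro sum_mono2) auto
  ultimately show ?thesis by simp
qed

lemma bloch_lacunary: "bloch lacunary"
proof -
  define f' where "f' n z = of_nat (4 ^ n) * z ^ (4 ^ n - 1)" for n and z :: complex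
  have "\<exists>g g'. \<forall>z\<in>ball 0 1. ((\<lambda>n. z ^ 4 ^ n) sums g z) \<and> ((\<lambda>n. f' n z) sums g' z) \<and>
      (g has_field_derivative g' z) (at z)"
  proof (rule series_and_derivative_comparison_complex)
    show "((\<lambda>z. z ^ 4 ^ n) has_field_derivative f' n z) (at z)" for n z
      unfolding f'_def by (auto intro!: derivative_eq_intros)
    fix x :: complex assume x: "x \<in> ball 0 1"
    \<comment> \<open>The ball of radius \<open>r - norm x\<close> around \<open>x\<close> stays
      within modulus \<open>r < 1\<close>, which gives the geometric majorant for locally uniform
      convergence.\<close>
    define r where "r = (1 + norm x) / 2"
    have r: "norm x < r" "r < 1" "0 \<le> r" using x by (auto simp: r_def)
    have "norm (y ^ 4 ^ n) \<le> norm (complex_of_real (r ^ n))" if "y \<in> ball x (r - norm x) \<inter> ball 0 1" for y n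
    proof -
      have "norm y \<le> norm x + norm (y - x)" by (rule norm_triangle_sub)
      also have "\<dots> \<le> r" using that by (simp add: dist_norm norm_minus_commute)
      finally have "norm y ^ 4 ^ n \<le> r ^ 4 ^ n" by (intro power_mono) auto
      also have "\<dots> \<le> r ^ n" using r less_four_power by (intro power_decreasing) (auto intro: less_imp_le)
      finally show ?thesis using r by (simp add: norm_power)
    qed
    moreover have "summable (\<lambda>n. complex_of_real (r ^ n))"
      using r by (simp add: summable_geometric)
    ultimately have "0 < r - norm x \<and> summable (\<lambda>n. complex_of_real (r ^ n)) \<and>
        range (\<lambda>n. complex_of_real (r ^ n)) \<subseteq> \<real>\<^sub>\<ge>\<^sub>0 \<and>
        (\<forall>\<^sub>F n in sequentially. \<forall>y\<in>ball x (r - norm x) \<inter> ball 0 1. norm (y ^ 4 ^ n) \<le> norm (complex_of_real (r ^ n)))"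
      using r by (auto simp del: of_real_power)
    thus "\<exists>d (h :: nat \<Rightarrow> complex). 0 < d \<and> summable h \<and> range h \<subseteq> \<real>\<^sub>\<ge>\<^sub>0 \<and>
        (\<forall>\<^sub>F n in sequentially. \<forall>y\<in>ball x d \<inter> ball 0 1. norm (y ^ 4 ^ n) \<le> norm (h n))"
      by - (rule exI, rule exI, assumption)
  qed simp
  then obtain g g' where g: "\<And>z. z \<in> ball 0 1 \<Longrightarrow> (\<lambda>n. z ^ 4 ^ n) sums g z"
    "\<And>z. z \<in> ball 0 1 \<Longrightarrow> (\<lambda>n. f' n z) sums g' z"
    "\<And>z. z \<in> ball 0 1 \<Longrightarrow> (g has_field_derivative g' z) (at z)" by blast
  have deriv: "(lacunary has_field_derivative g' z) (at z)" if "z \<in> ball 0 1" for z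
    using g(3)[OF that] that
    by (rule has_field_derivative_transform_within_open[OF _ open_ball])
       (simp add: lacunary_def sums_unique[OF g(1)])
  have "norm (deriv lacunary z) * (1 - (norm z)\<^sup>2) \<le> 4" if z: "z \<in> ball 0 1" for z
  proof -
    have z1: "norm z < 1" using z by simp
    have "norm (g' z) \<le> 2 / (1 - norm z)"
    proof (rule LIMSEQ_le_const2)
      show "(\<lambda>N. norm (\<Sum>n<N. f' n z)) \<longlonglongrightarrow> norm (g' z)"
        using g(2)[OF z] by (intro tendsto_norm) (simp add: sums_def)
      have "norm (\<Sum>n<N. f' n z) \<le> 2 / (1 - norm z)" for N
      proof -
        have "norm (\<Sum>n<N. f' n z) \<le> (\<Sum>n<N. 4 ^ n * norm z ^ (4 ^ n - 1))"
          by (rule order_trans[OF norm_sum]) (simp add: f'_def norm_mult norm_power)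
        also have "\<dots> \<le> 2 / (1 - norm z)"
          using lacunary_derivative_sum_le z1 by simp
        finally show ?thesis .
      qed
      thus "\<exists>N. \<forall>n\<ge>N. norm (\<Sum>n<n. f' n z) \<le> 2 / (1 - norm z)" by blast
    qed
    moreover have "0 \<le> 1 - (norm z)\<^sup>2" using z1 by (simp add: power_le_one)
    ultimately have "norm (g' z) * (1 - (norm z)\<^sup>2) \<le> 2 / (1 - norm z) * (1 - (norm z)\<^sup>2)"
      by (rule mult_right_mono)
    also have "\<dots> = 2 * (1 + norm z)"
      using z1 by (simp add: power2_eq_square field_simps)
    also have "\<dots> \<le> 4" using z1 by simp
    finally show ?thesis using DERIV_imp_deriv[OF deriv[OF z]] by simp
  qed
  moreover have "lacunary holomorphic_on ball 0 1"
    unfolding holomorphic_on_open[OF open_ball] using deriv by blast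
  ultimately show ?thesis unfolding bloch_def by blast
qed

lemma lacunary_0: "lacunary 0 = 0"
  by (simp add: lacunary_def power_0_left)

text \<open>Moving the first \<open>k\<close> terms from the unit circle to radius \<open>r\<close>
  costs at most the sum of 4^n / 4^k, which is below 1, by Bernoulli's inequality. The tail is at
  most the sum of 2^-(n+1), again 1.\<close>

lemma Re_lacunary_ge:
  fixes k :: nat
  defines "r \<equiv> 1 - 1 / 4 ^ k"
  assumes "k > 0"
  shows "(\<Sum>n<k. cos (4 ^ n * x)) - 2 \<le> Re (lacunary (of_real r * cis x))"
proof -
  define z where "z = of_real r * cis x"
  have r: "0 \<le> r" "r < 1" by (auto simp: r_def)
  have nz: "norm z = r" using r by (simp add: z_def norm_mult)
  have z1: "norm z < 1" using nz r by simp
  have summ: "summable (\<lambda>n. z ^ 4 ^ n)"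
    by (rule summable_norm_cancel[OF summable_lacunary[OF z1]])
  have "Re (z ^ 4 ^ n) \<ge> cos (4 ^ n * x) - 4 ^ n / 4 ^ k" for n
  proof -
    have "1 + real (4 ^ n) * (- 1 / 4 ^ k) \<le> (1 + (- 1 / 4 ^ k)) ^ 4 ^ n"
      by (rule Bernoulli_inequality) (use r in \<open>simp add: r_def\<close>)
    hence rn: "1 - r ^ 4 ^ n \<le> 4 ^ n / 4 ^ k" by (simp add: r_def)
    have "0 \<le> 1 - r ^ 4 ^ n" using r by (simp add: power_le_one)
    hence "(1 - r ^ 4 ^ n) * cos (4 ^ n * x) \<le> (1 - r ^ 4 ^ n) * 1"
      by (intro mult_left_mono) auto
    moreover have "Re (z ^ 4 ^ n) = r ^ 4 ^ n * cos (4 ^ n * x)"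
      by (simp add: z_def power_mult_distrib Complex.DeMoivre flip: of_real_power)
    ultimately show ?thesis using rn by (simp add: algebra_simps)
  qed
  hence head_le: "(\<Sum>n<k. cos (4 ^ n * x) - 4 ^ n / 4 ^ k) \<le> Re (\<Sum>n<k. z ^ 4 ^ n)"
    unfolding Re_sum by (intro sum_mono)
  have "(\<Sum>n<k. 4 ^ n) = ((4 ^ k - 1) / 3 :: real)"
    by (induction k) auto
  also have "\<dots> \<le> 4 ^ k" by (simp add: field_simps order_trans[of _ 0])
  finally have "(\<Sum>n<k. 4 ^ n) \<le> (4 ^ k :: real)" .
  hence "(\<Sum>n<k. 4 ^ n / 4 ^ k) \<le> (1 :: real)"
    by (simp flip: sum_divide_distrib)
  with head_le have head: "(\<Sum>n<k. cos (4 ^ n * x)) - 1 \<le> Re (\<Sum>n<k. z ^ 4 ^ n)"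
    by (simp add: sum_subtractf)
  have tail_term: "norm (z ^ 4 ^ (n + k)) \<le> (1 / 2) ^ Suc n" for n
  proof -
    have "r ^ 4 ^ k \<le> 1 / 2"
      by (rule power_one_minus_inverse_le_half) (use r in \<open>auto simp: r_def\<close>)
    hence "(r ^ 4 ^ k) ^ 4 ^ n \<le> (1 / 2) ^ 4 ^ n" using r by (intro power_mono) auto
    also have "\<dots> \<le> (1 / 2) ^ Suc n" using less_four_power[of n] by (intro power_decreasing) auto
    finally show ?thesis by (simp add: norm_power nz power_add power_mult mult.commute flip: power_mult)
  qed
  have half: "(\<lambda>n. (1 / 2 :: real) ^ Suc n) sums 1"
    using power_half_series by simp
  have "norm (\<Sum>n. z ^ 4 ^ (n + k)) \<le> (\<Sum>n. (1 / 2) ^ Suc n)"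
    using tail_term half by (intro norm_suminf_le) (auto simp: sums_iff)
  hence "norm (\<Sum>n. z ^ 4 ^ (n + k)) \<le> 1" using half by (simp add: sums_iff)
  hence "- 1 \<le> Re (\<Sum>n. z ^ 4 ^ (n + k))"
    using abs_Re_le_cmod[of "\<Sum>n. z ^ 4 ^ (n + k)"] by linarith
  moreover have "lacunary z = (\<Sum>n. z ^ 4 ^ (n + k)) + (\<Sum>n<k. z ^ 4 ^ n)"
    unfolding lacunary_def by (rule suminf_split_initial_segment[OF summ])
  ultimately show ?thesis using head unfolding z_def by simp
qed

section \<open>The sequence\<close>

text \<open>Telescoping differences of 1 / ln have size about 1 / (i (ln i)^2), and any positive
  \<open>\<tau>\<close> lifts the power above 1 / i eventually.\<close>

lemma exists_summable_nonsummable_powers: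
  "\<exists>e :: nat \<Rightarrow> real. (\<forall>i. 0 < e i \<and> e i \<le> 1) \<and> summable e \<and>
     (\<forall>\<tau>>0. \<not> summable (\<lambda>i. e i powr (1 - \<tau>)))"
proof -
  define e where "e i = 1 / ln (real i + 3) - 1 / ln (real i + 4)" for i :: nat
  have ln3: "1 \<le> ln (real i + 3)" for i :: nat
    using ln_ge_iff[of "real i + 3" 1] exp_le by simp
  have pos: "0 < e i" for i
    unfolding e_def using ln3[of i] by (simp add: frac_less2)
  have le1: "e i \<le> 1" for i
  proof -
    have "1 / ln (real i + 3) \<le> 1" using ln3[of i] by simp
    moreover have "0 \<le> 1 / ln (real i + 4)" by simp
    ultimately show ?thesis by (simp only: e_def)
  qed
  have "(\<lambda>i. 1 / ln (real i + 3)) \<longlonglongrightarrow> 0" by real_asymp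
  hence "summable (\<lambda>i. 1 / ln (real i + 3) - 1 / ln (real (Suc i) + 3))"
    by (rule telescope_summable')
  hence "summable e" unfolding e_def[abs_def] by (simp add: add.commute)
  moreover have "\<not> summable (\<lambda>i. e i powr (1 - \<tau>))" if "\<tau> > 0" for \<tau>
  proof
    assume s: "summable (\<lambda>i. e i powr (1 - \<tau>))"
    have "\<forall>\<^sub>F i in sequentially. 1 / real i \<le> e i powr (1 - \<tau>)"
      unfolding e_def using that by real_asymp
    hence "\<forall>\<^sub>F i in sequentially. norm (1 / real i) \<le> e i powr (1 - \<tau>)"
      by simp
    hence "summable (\<lambda>i. 1 / real i)"
      using s by (rule summable_comparison_test_ev)
    thus False using not_summable_harmonic[where 'a = real] by (simp add: inverse_eq_divide)
  qed
  ultimately show ?thesis using pos le1 by blast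
qed

section \<open>Base 4 grids in the disc and their kernel sums\<close>

definition grid_point :: "nat \<Rightarrow> nat \<Rightarrow> complex" where
  "grid_point k a = of_real (1 - 1 / 4 ^ k) * cis (2 * pi * a / 4 ^ k)"

lemma norm_grid_point: "norm (grid_point k a) = 1 - 1 / 4 ^ k"
proof -
  have "1 / 4 ^ k \<le> (1 :: real)" by simp
  thus ?thesis by (simp only: grid_point_def norm_mult norm_of_real norm_cis abs_of_nonneg diff_ge_0_iff_ge mult_1_right)
qed

lemma norm_grid_point_less_1: "norm (grid_point k a) < 1"
  by (simp add: norm_grid_point)

lemma one_minus_norm_grid_point_sq:
  "1 / 4 ^ k \<le> 1 - (norm (grid_point k a))\<^sup>2" "1 - (norm (grid_point k a))\<^sup>2 \<le> 2 / 4 ^ k"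
proof -
  define q where "q = (1 / 4 ^ k :: real)"
  have q: "0 \<le> q" "q \<le> 1" by (auto simp: q_def)
  have "1 - (norm (grid_point k a))\<^sup>2 = 2 * q - q * q"
    unfolding norm_grid_point q_def[symmetric] by (simp add: power2_eq_square algebra_simps)
  moreover have "q * q \<le> q" using q by (simp add: mult_left_le)
  ultimately have "q \<le> 1 - (norm (grid_point k a))\<^sup>2" "1 - (norm (grid_point k a))\<^sup>2 \<le> 2 * q"
    using q by auto
  thus "1 / 4 ^ k \<le> 1 - (norm (grid_point k a))\<^sup>2" "1 - (norm (grid_point k a))\<^sup>2 \<le> 2 / 4 ^ k"
    by (simp_all add: q_def)
qed

text \<open>The leading digits \<open>h\<close> act as rotations by 4^k-th roots of unity, so a
  condition on the digits \<open>j\<close> alone selects whole orbits.\<close>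

lemma grid_point_rotate:
  "grid_point (k + m) (h * 4 ^ m + j) = grid_point (k + m) j * cis (2 * pi * h / 4 ^ k)"
proof -
  have "2 * pi * real (h * 4 ^ m + j) / 4 ^ (k + m) = 2 * pi * j / 4 ^ (k + m) + 2 * pi * h / 4 ^ k"
    by (simp add: power_add field_simps)
  thus ?thesis by (simp add: grid_point_def mult.assoc cis_mult del: of_nat_add)
qed

lemma kern_same_grid_le_half:
  assumes "k > 0" "a < 4 ^ k" "a' < 4 ^ k" "a \<noteq> a'"
  shows "kern (grid_point k a) (grid_point k a') \<le> 1 / 2"
  using assms
proof (induction a a' rule: linorder_wlog)
  case (sym a b)
  thus ?case by (metis kern_commute)
next
  case (le a a')
  define \<omega> where "\<omega> = cis (2 * pi * (a' - a) / 4 ^ k)"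
  have "2 * pi * real a' / 4 ^ k = 2 * pi * real a / 4 ^ k + 2 * pi * real (a' - a) / 4 ^ k"
    using le by (simp add: field_simps)
  hence a': "grid_point k a' = grid_point k a * \<omega>"
    by (simp add: grid_point_def \<omega>_def mult.assoc cis_mult del: of_nat_diff)
  have "\<omega> = exp (2 * of_real pi * \<i> * of_nat (a' - a) / of_nat (4 ^ k))"
    by (simp add: \<omega>_def cis_conv_exp mult_ac del: of_nat_diff)
  hence "\<omega> = 1 \<longleftrightarrow> 4 ^ k dvd a' - a"
    using complex_root_unity_eq_1[of "4 ^ k" "a' - a"] by simp
  hence ne: "\<omega> \<noteq> 1" using le by (auto dest!: dvd_imp_le)
  have "\<omega> ^ 4 ^ k = cis (2 * pi * (a' - a))"
    by (simp add: \<omega>_def Complex.DeMoivre del: of_nat_diff)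
  also have "\<dots> = 1" by (metis cis_multiple_2pi Ints_of_nat)
  finally have one: "\<omega> ^ 4 ^ k = 1" .
  have "1 < (4::nat) ^ k" using \<open>k > 0\<close> by (intro one_less_power) auto
  thus ?case unfolding a'
    using one ne by (intro kern_same_circle_le_half[where M = "4 ^ k"]) (auto simp: norm_grid_point \<omega>_def)
qed

lemma kern_distant_grids_le_half:
  assumes "k + 2 \<le> k'"
  shows "kern (grid_point k a) (grid_point k' a') \<le> 1 / 2"
proof (rule kern_distant_circles_le_half)
  have "(4::real) ^ (k + 2) \<le> 4 ^ k'" using assms by (intro power_increasing) auto
  hence "8 / 4 ^ k' \<le> 8 / (4::real) ^ (k + 2)" by (intro divide_left_mono) auto
  also have "\<dots> \<le> 1 / 4 ^ k" by (simp add: field_simps)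
  finally show "8 * (1 - norm (grid_point k' a')) \<le> 1 - norm (grid_point k a)"
    by (simp add: norm_grid_point)
qed (rule norm_grid_point_less_1)+

text \<open>Equidistribution seen from a point no deeper than the rotation step: every orbit
  contributes at most 8 / 4^m, so the total is proportional to the density of
  \<open>W\<close>.\<close>

lemma sum_kern_coarse_rotations_le:
  assumes "k' \<le> k" "finite W"
  shows "(\<Sum>j\<in>W. \<Sum>h<4^k. kern (grid_point k' a) (grid_point (k + m) (h * 4 ^ m + j))) \<le> 8 * (card W / 4 ^ m)"
proof -
  have "(\<Sum>h<4^k. kern (grid_point k' a) (grid_point (k + m) (h * 4 ^ m + j))) \<le> 8 / 4 ^ m" for j
  proof -
    have "1 / 4 ^ k \<le> 1 / (4::real) ^ k'" using assms(1) by (intro divide_left_mono power_increasing) auto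
    moreover have "norm (grid_point k' a) * norm (grid_point (k + m) j) \<le> norm (grid_point k' a)"
      using norm_grid_point_less_1[of "k + m" j] by (simp add: mult_left_le)
    ultimately have "norm (grid_point k' a) * norm (grid_point (k + m) j) \<le> 1 - 1 / 4 ^ k"
      unfolding norm_grid_point[of k'] by linarith
    hence "(\<Sum>h<4^k. kern (grid_point k' a) (grid_point (k + m) j * cis (2 * pi * real h / real (4 ^ k))))
        \<le> 4 * (4 ^ k) * (1 - (norm (grid_point (k + m) j))\<^sup>2)"
      using sum_kern_rotations_le(2)[OF norm_grid_point_less_1 norm_grid_point_less_1, of "4 ^ k" k' a "k + m" j] by simp
    also have "\<dots> \<le> 4 * (4 ^ k) * (2 / 4 ^ (k + m))"
      by (intro mult_left_mono one_minus_norm_grid_point_sq) auto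
    finally show ?thesis by (simp add: grid_point_rotate power_add)
  qed
  hence "(\<Sum>j\<in>W. \<Sum>h<4^k. kern (grid_point k' a) (grid_point (k + m) (h * 4 ^ m + j))) \<le> (\<Sum>j\<in>W. 8 / 4 ^ m)"
    by (intro sum_mono)
  thus ?thesis by (simp add: mult.commute)
qed

text \<open>Completing \<open>W\<close> to the full grid loses its sparsity, but the bound decays
  geometrically in \<open>k' - (k + m)\<close>, which suffices for generations no deeper than the
  given point.\<close>

lemma sum_kern_full_grid_le:
  assumes "W \<subseteq> {..<4^m}" "k + m > 0"
  shows "(\<Sum>j\<in>W. \<Sum>h<4^k. kern (grid_point k' a) (grid_point (k + m) (h * 4 ^ m + j))) \<le> 8 * 4 ^ (k + m) / 4 ^ k'"
proof -
  define r where "r = complex_of_real (1 - 1 / 4 ^ (k + m))"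
  have r: "norm r = 1 - 1 / 4 ^ (k + m)"
    using norm_grid_point[of "k + m" 0] by (simp add: r_def grid_point_def)
  have nn: "0 \<le> kern (grid_point k' a) (grid_point (k + m) b)" for b
    by (intro kern_nonneg norm_grid_point_less_1)
  have "(\<Sum>j\<in>W. \<Sum>h<4^k. kern (grid_point k' a) (grid_point (k + m) (h * 4 ^ m + j)))
     \<le> (\<Sum>j<4^m. \<Sum>h<4^k. kern (grid_point k' a) (grid_point (k + m) (h * 4 ^ m + j)))"
    using assms by (intro sum_mono2 sum_nonneg nn) auto
  also have "\<dots> = (\<Sum>b<4^(k + m). kern (grid_point k' a) (r * cis (2 * pi * real b / real (4 ^ (k + m)))))"
    by (subst sum_lessThan_mult[symmetric]) (simp add: power_add r_def grid_point_def)
  also have "\<dots> \<le> 4 * (4 ^ (k + m)) * (1 - (norm (grid_point k' a))\<^sup>2)"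
  proof -
    have "norm (grid_point k' a) * norm r \<le> norm r"
      using norm_grid_point_less_1[of k' a] by (simp add: mult_left_le_one_le)
    hence "norm (grid_point k' a) * norm r \<le> 1 - 1 / real (4 ^ (k + m))" using r by simp
    moreover have "norm r < 1" using r by simp
    ultimately show ?thesis
      using sum_kern_rotations_le(1)[OF norm_grid_point_less_1, of r "4 ^ (k + m)" k' a] by simp
  qed
  also have "\<dots> \<le> 4 * (4 ^ (k + m)) * (2 / 4 ^ k')"
    by (intro mult_left_mono one_minus_norm_grid_point_sq) auto
  finally show ?thesis by simp
qed

section \<open>Size of the Bloch function at selected grid points\<close>

lemma lacunary_grid_point_ge:
  fixes K s h j :: nat
  defines "m \<equiv> s * (64 * (K + 2)\<^sup>2)"
  assumes "s > 0" and j: "s * sqrt (64 * (K + 2)\<^sup>2) / 4 \<le> cos_sum m j"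
  shows "s * (K + 2) \<le> norm (lacunary (grid_point (K + m) (h * 4 ^ m + j)))"
proof -
  have m: "m > 0" using assms(2) by (simp add: m_def)
  \<comment> \<open>The new digits contribute 2 s (K + 2). The \<open>K\<close> old digits cost at
    most \<open>K\<close> and leaving the circle costs 2; together this is at most s (K +
    2).\<close>
  have "sqrt (64 * (K + 2)\<^sup>2) = 8 * (K + 2)"
    by (simp add: real_sqrt_mult)
  hence "2 * (s * (K + 2)) \<le> cos_sum m j" using j by (simp add: algebra_simps)
  moreover have "- real K \<le> cos_sum K (real h + real j / 4 ^ m)"
  proof -
    have "(\<Sum>n<K. - 1) \<le> cos_sum K (real h + real j / 4 ^ m)"
      unfolding cos_sum_def by (intro sum_mono) simp
    thus ?thesis by simp
  qed
  moreover have "cos_sum (K + m) (h * 4 ^ m + j) = cos_sum K (real h + real j / 4 ^ m) + cos_sum m j"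
    using cos_sum_add[of K m h "real j"] by simp
  moreover have "cos_sum (K + m) (h * 4 ^ m + j) - 2 \<le> Re (lacunary (grid_point (K + m) (h * 4 ^ m + j)))"
  proof -
    have "(\<Sum>n<K + m. cos (4 ^ n * (2 * pi * real (h * 4 ^ m + j) / 4 ^ (K + m)))) = cos_sum (K + m) (h * 4 ^ m + j)"
      unfolding cos_sum_def by (intro sum.cong arg_cong[where f = cos]) (auto simp: mult_ac)
    thus ?thesis
      using Re_lacunary_ge[of "K + m" "2 * pi * real (h * 4 ^ m + j) / 4 ^ (K + m)"] m
      by (simp only: grid_point_def)
  qed
  moreover have "real K + 2 \<le> real s * real K + 2 * real s"
  proof -
    have "1 * real K \<le> real s * real K" using assms(2) by (intro mult_right_mono) auto
    moreover have "1 \<le> real s" using assms(2) by simp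
    ultimately show ?thesis by linarith
  qed
  ultimately show ?thesis
    using complex_Re_le_cmod[of "lacunary (grid_point (K + m) (h * 4 ^ m + j))"]
    by (simp only: of_nat_mult of_nat_add of_nat_numeral distrib_left)
qed

lemma neg_ln_one_minus_norm_grid_point_sq:
  assumes "k > 0"
  shows "0 < - ln (1 - (norm (grid_point k a))\<^sup>2)" "- ln (1 - (norm (grid_point k a))\<^sup>2) \<le> 2 * k"
proof -
  define q where "q = 1 - (norm (grid_point k a))\<^sup>2"
  have q: "1 / 4 ^ k \<le> q" using one_minus_norm_grid_point_sq(1) by (simp add: q_def)
  have q0: "0 < q" by (rule less_le_trans[OF _ q]) simp
  have "(4::real) ^ 1 \<le> 4 ^ k" using assms by (intro power_increasing) auto
  hence "0 < norm (grid_point k a)" by (simp add: norm_grid_point)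
  hence q1: "q < 1" by (simp add: q_def)
  show "0 < - ln (1 - (norm (grid_point k a))\<^sup>2)" using q0 q1 by (simp add: q_def[symmetric])
  have "- ln q \<le> - ln (1 / 4 ^ k)" using q q0 by (simp add: ln_le_cancel_iff)
  also have "\<dots> = k * ln 4" by (simp add: ln_div ln_realpow)
  also have "\<dots> \<le> real k * 2"
  proof (intro mult_left_mono)
    have "ln (2::real) \<le> 1" using ln_le_minus_one[of 2] by simp
    moreover have "ln (4::real) = 2 * ln 2" using ln_realpow[of 2 2] by simp
    ultimately show "ln 4 \<le> (2::real)" by simp
  qed simp
  finally show "- ln (1 - (norm (grid_point k a))\<^sup>2) \<le> 2 * k" by (simp add: q_def mult.commute)
qed

text \<open>The depth K + m is at most 65 s (K + 2)^2, so the logarithm is at most 130 s (K + 2)^2,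
  while |b|^2 is at least s^2 (K + 2)^2.\<close>

lemma lacunary_exponent_ge:
  fixes K s h j :: nat
  defines "m \<equiv> s * (64 * (K + 2)\<^sup>2)"
  defines "z \<equiv> grid_point (K + m) (h * 4 ^ m + j)"
  assumes "s > 0" and "s * sqrt (64 * (K + 2)\<^sup>2) / 4 \<le> cos_sum m j"
  shows "s / 130 \<le> (norm (lacunary z - lacunary 0))\<^sup>2 / (- ln (1 - (norm z)\<^sup>2))"
proof -
  define L where "L = - ln (1 - (norm z)\<^sup>2)"
  have "K + m > 0" using assms(3) by (simp add: m_def)
  hence L: "0 < L" "L \<le> 2 * real (K + m)"
    using neg_ln_one_minus_norm_grid_point_sq[of "K + m"] by (auto simp: L_def z_def)
  have "K \<le> s * (K + 2)\<^sup>2"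
  proof -
    have "K \<le> 1 * (K + 2)\<^sup>2" by (simp add: power2_eq_square)
    also have "\<dots> \<le> s * (K + 2)\<^sup>2" using assms(3) by (intro mult_right_mono) auto
    finally show ?thesis .
  qed
  hence "K + m \<le> 65 * (s * (K + 2)\<^sup>2)" by (simp add: m_def)
  hence "real (K + m) \<le> real (65 * (s * (K + 2)\<^sup>2))" by (simp only: of_nat_le_iff)
  hence "L \<le> 130 * (s * (real (K + 2))\<^sup>2)" using L by simp
  hence "s / 130 * L \<le> s / 130 * (130 * (s * (real (K + 2))\<^sup>2))"
    by (intro mult_left_mono) auto
  also have "\<dots> = (real (s * (K + 2)))\<^sup>2" by (simp add: power2_eq_square algebra_simps)
  also have "\<dots> \<le> (norm (lacunary z))\<^sup>2"
    using lacunary_grid_point_ge[OF assms(3), of K j h] assms(4)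
    by (intro power_mono) (auto simp: z_def m_def)
  finally show ?thesis using L(1) by (simp add: lacunary_0 L_def[symmetric] pos_le_divide_eq)
qed

text \<open>The choice of \<open>s\<close> gives 1024^-s >= e / 1024, so enough good digit strings
  exist to keep a fraction of about e / 1024. Rounding up the cardinality costs 4^-m. The lower
  density bound serves divergence, the upper one the Carleson condition.\<close>

lemma exists_digit_set:
  fixes e :: real and K :: nat
  assumes "0 < e" "e \<le> 1"
  defines "s \<equiv> Suc (nat \<lfloor>ln (1 / e) / ln 1024\<rfloor>)"
  defines "m \<equiv> s * (64 * (K + 2)\<^sup>2)"
  shows "\<exists>W :: nat set. W \<subseteq> {..<4^m} \<and> (\<forall>j\<in>W. s * sqrt (64 * (K + 2)\<^sup>2) / 4 \<le> cos_sum m j) \<and>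
     e / 1024 \<le> card W / 4 ^ m \<and> card W / 4 ^ m \<le> e + 1 / 4 ^ m"
proof -
  define G where "G = {j. j < 4 ^ m \<and> s * sqrt (64 * (K + 2)\<^sup>2) / 4 \<le> cos_sum m (real j)}"
  define x where "x = ln (1 / e) / ln 1024"
  have x: "0 \<le> x" using assms(1,2) by (simp add: x_def)
  hence s: "real s \<le> 1 + x" by (simp add: s_def x_def)
  have "e / 1024 = exp (- ln 1024 * (1 + x))"
    using assms(1) by (simp add: x_def algebra_simps exp_diff exp_minus ln_div)
  also have "\<dots> \<le> exp (- ln 1024 * s)" using s by simp
  also have "\<dots> = (1 / 1024) ^ s" by (simp add: exp_minus power_one_over inverse_eq_divide mult.commute[of _ "real s"] exp_of_nat_mult)
  finally have e: "e / 1024 \<le> (1 / 1024) ^ s" .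
  have "(4 ^ (64 * (K + 2)\<^sup>2) / 1024) ^ s = 4 ^ m * (1 / 1024 :: real) ^ s"
    by (simp add: m_def power_divide mult.commute flip: power_mult)
  moreover have "(4 ^ (64 * (K + 2)\<^sup>2) / 1024) ^ s \<le> real (card G)"
    using card_cos_sum_ge_blocks[of "64 * (K + 2)\<^sup>2" s] by (simp add: G_def m_def)
  moreover have "4 ^ m * (e / 1024) \<le> 4 ^ m * (1 / 1024) ^ s" using e by (intro mult_left_mono) auto
  ultimately have "4 ^ m * (e / 1024) \<le> real (card G)" by linarith
  hence "nat \<lceil>4 ^ m * (e / 1024)\<rceil> \<le> card G" by (simp add: ceiling_le_iff)
  then obtain W where W: "W \<subseteq> G" "card W = nat \<lceil>4 ^ m * (e / 1024)\<rceil>"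
    by (meson obtain_subset_with_card_n)
  have "0 \<le> 4 ^ m * (e / 1024)" using assms(1) by simp
  hence "4 ^ m * (e / 1024) \<le> card W" "card W \<le> 4 ^ m * (e / 1024) + 1"
    unfolding W(2) by linarith+
  moreover have "4 ^ m * (e / 1024) \<le> 4 ^ m * e" using assms(1) by (intro mult_left_mono) auto
  ultimately have "e / 1024 \<le> card W / 4 ^ m" "card W / 4 ^ m \<le> e + 1 / 4 ^ m"
    by (simp_all add: pos_le_divide_eq pos_divide_le_eq algebra_simps)
  thus ?thesis using W(1) by (intro exI[of _ W]) (auto simp: G_def)
qed

section \<open>Depths of the generations and assembly of the sequence\<close>

text \<open>Block length \<open>64 (K + 2)^2\<close> makes the new digits, which contribute \<open>2 s (K + 2)\<close> to the cosine
  sum, outweigh the at most \<open>K\<close> coming from the old ones.\<close>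

primrec depth :: "(nat \<Rightarrow> nat) \<Rightarrow> nat \<Rightarrow> nat" where
  "depth s 0 = 0"
| "depth s (Suc i) = depth s i + s i * (64 * (depth s i + 2)\<^sup>2)"

lemma le_block_length:
  fixes K s :: nat
  assumes "s > 0"
  shows "K + 2 \<le> s * (64 * (K + 2)\<^sup>2)"
proof -
  have "K + 2 \<le> 1 * (64 * (K + 2)\<^sup>2)" by (simp add: power2_eq_square)
  also have "\<dots> \<le> s * (64 * (K + 2)\<^sup>2)" using assms by (intro mult_right_mono) auto
  finally show ?thesis .
qed

lemma depth_Suc_ge:
  assumes "\<And>i. s i > 0"
  shows "depth s i + 2 \<le> depth s (Suc i)"
  unfolding depth.simps by (rule trans_le_add2[OF le_block_length[OF assms]])

lemma depth_mono:
  assumes "\<And>i. s i > 0" "i \<le> i'"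
  shows "depth s i + (i' - i) \<le> depth s i'"
  using assms(2)
proof (induction i' rule: dec_induct)
  case (step n)
  thus ?case using depth_Suc_ge[of s n, OF assms(1)] by (simp del: depth.simps)
qed simp

text \<open>In a triple (i, j, h), \<open>i\<close> is the generation, \<open>j\<close> the selected
  new digits and \<open>h\<close> the unrestricted old ones. Seen from generation i0, earlier
  generations and i0 itself give a geometric series bounded by 16, and the later ones at most 8
  times their densities.\<close>

lemma interpolating_generations:
  fixes s :: "nat \<Rightarrow> nat" and W :: "nat \<Rightarrow> nat set" and g :: "nat \<Rightarrow> nat \<times> nat \<times> nat"
  defines "K \<equiv> depth s"
  defines "m \<equiv> (\<lambda>i. s i * (64 * (K i + 2)\<^sup>2))"
  defines "P \<equiv> (\<lambda>(i, j, h). grid_point (K i + m i) (h * 4 ^ m i + j))"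
  assumes s: "\<And>i. s i > 0"
    and W: "\<And>i. W i \<subseteq> {..<4 ^ m i}"
    and density: "\<And>n. (\<Sum>i<n. card (W i) / 4 ^ m i) \<le> D"
    and g: "inj g" "range g \<subseteq> (SIGMA i:UNIV. W i \<times> {..<4 ^ K i})"
  shows "interpolating (P \<circ> g)"
proof (rule interpolating_if_kern_sums_bounded)
  have K: "K (Suc i) = K i + m i" for i by (simp add: K_def m_def)
  have K_mono: "K i + (i' - i) \<le> K i'" if "i \<le> i'" for i i'
    unfolding K_def using s that by (rule depth_mono)
  have finW: "finite (W i)" for i using W finite_subset by blast
  have m2: "K i + 2 \<le> m i" for i unfolding m_def by (rule le_block_length[OF s])
  show "norm ((P \<circ> g) n) < 1" for n
    by (simp add: P_def norm_grid_point_less_1 split: prod.split)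
  show "(\<Sum>k\<in>F. kern ((P \<circ> g) n) ((P \<circ> g) k)) \<le> 16 + 8 * D" if "finite F" for F n
  proof -
    obtain i0 j0 h0 where gn: "g n = (i0, j0, h0)" by (cases "g n")
    define z where "z = P (g n)"
    define a where "a = h0 * 4 ^ m i0 + j0"
    have z: "z = grid_point (K (Suc i0)) a" by (simp add: z_def P_def gn a_def K)
    define S where "S i = (\<Sum>j\<in>W i. \<Sum>h<4^K i. kern z (grid_point (K i + m i) (h * 4 ^ m i + j)))" for i
    \<comment> \<open>Generations up to \<open>i0\<close> are compared with full grids, the later ones by equidistribution.\<close>
    define q where "q i = (if i \<le> i0 then (1 / 2 :: real) ^ (i0 - i) else 0)" for i
    have S: "S i \<le> 8 * q i + 8 * (card (W i) / 4 ^ m i)" for i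
    proof (cases "i \<le> i0")
      case True
      have "S i \<le> 8 * 4 ^ K (Suc i) / 4 ^ K (Suc i0)"
        unfolding S_def z K[of i] using m2[of i] by (intro sum_kern_full_grid_le W) simp
      also have "\<dots> \<le> 8 * (1 / 2) ^ (i0 - i)"
      proof -
        \<comment> \<open>Each generation deepens by at least one level; the resulting ratio 1/4 is
          weakened to 1/2.\<close>
        have "(4::real) ^ (K (Suc i) + (i0 - i)) \<le> 4 ^ K (Suc i0)"
          using K_mono[of "Suc i" "Suc i0"] True by (intro power_increasing) auto
        hence "(4::real) ^ K (Suc i) * 4 ^ (i0 - i) \<le> 4 ^ K (Suc i0)" by (simp add: power_add)
        moreover have "(4::real) ^ K (Suc i) * 2 ^ (i0 - i) \<le> 4 ^ K (Suc i) * 4 ^ (i0 - i)"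
          by (intro mult_left_mono power_mono) auto
        ultimately have "(4::real) ^ K (Suc i) * 2 ^ (i0 - i) \<le> 4 ^ K (Suc i0)" by linarith
        thus ?thesis by (simp add: field_simps power_divide)
      qed
      finally show ?thesis using True by (simp add: q_def add_increasing2)
    next
      case False
      hence "K (Suc i0) \<le> K i" using K_mono[of "Suc i0" i] by simp
      hence "S i \<le> 8 * (card (W i) / 4 ^ m i)"
        unfolding S_def z by (rule sum_kern_coarse_rotations_le[OF _ finW])
      thus ?thesis using False by (simp add: q_def)
    qed
    have q: "(\<Sum>i<N. q i) \<le> 2" for N
    proof -
      have "(\<Sum>i<N. q i) \<le> (\<Sum>i<max N (Suc i0). q i)"
        by (intro sum_mono2) (auto simp: q_def)
      also have "\<dots> = (\<Sum>i\<le>i0. (1 / 2) ^ (i0 - i))"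
        by (intro sum.mono_neutral_cong_right) (auto simp: q_def)
      also have "\<dots> = (\<Sum>i\<le>i0. (1 / 2) ^ i)"
        by (rule sum.nat_diff_reindex[where n = "Suc i0", simplified lessThan_Suc_atMost, simplified])
      also have "\<dots> \<le> 2"
        unfolding lessThan_Suc_atMost[symmetric] by (simp add: sum_gp_strict)
      finally show ?thesis .
    qed
    obtain N where N: "fst ` g ` F \<subseteq> {..<N}"
      using \<open>finite F\<close> by (metis finite_imageI finite_nat_iff_bounded)
    have sub: "g ` F \<subseteq> (SIGMA i:{..<N}. W i \<times> {..<4 ^ K i})"
    proof
      fix x assume x: "x \<in> g ` F"
      hence "x \<in> (SIGMA i:UNIV. W i \<times> {..<4 ^ K i})" using g(2) by blast
      moreover have "fst x \<in> {..<N}" using x N by blast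
      ultimately show "x \<in> (SIGMA i:{..<N}. W i \<times> {..<4 ^ K i})" by (cases x) simp
    qed
    have "(\<Sum>k\<in>F. kern ((P \<circ> g) n) ((P \<circ> g) k)) = (\<Sum>x\<in>g ` F. kern z (P x))"
      using g(1) by (subst sum.reindex) (auto simp: z_def inj_on_def)
    also have "\<dots> \<le> (\<Sum>x\<in>(SIGMA i:{..<N}. W i \<times> {..<4 ^ K i}). kern z (P x))"
      using finW by (intro sum_mono2 sub)
        (auto simp: P_def z intro!: kern_nonneg norm_grid_point_less_1)
    also have "\<dots> = (\<Sum>i<N. \<Sum>x\<in>W i \<times> {..<4 ^ K i}. kern z (P (i, x)))"
      using finW by (subst sum.Sigma) (auto simp: split_def)
    also have "\<dots> = (\<Sum>i<N. S i)"
      by (simp add: S_def P_def sum.cartesian_product split_def)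
    also have "\<dots> \<le> (\<Sum>i<N. 8 * q i + 8 * (card (W i) / 4 ^ m i))"
      by (intro sum_mono S)
    also have "\<dots> = 8 * (\<Sum>i<N. q i) + 8 * (\<Sum>i<N. card (W i) / 4 ^ m i)"
      by (simp add: sum.distrib sum_distrib_left)
    also have "\<dots> \<le> 16 + 8 * D" using q[of N] density[of N] by linarith
    finally show ?thesis .
  qed
  show "kern ((P \<circ> g) n) ((P \<circ> g) n') \<le> 1 / 2" if "n \<noteq> n'" for n n'
  proof -
    obtain i j h where gn: "g n = (i, j, h)" by (cases "g n")
    obtain i' j' h' where gn': "g n' = (i', j', h')" by (cases "g n'")
    have digits: "j < 4 ^ m i \<and> h < 4 ^ K i" if "g n = (i, j, h)" for n i j h
    proof -
      have "(i, j, h) \<in> (SIGMA i:UNIV. W i \<times> {..<4 ^ K i})"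
        using g(2) rangeI[of g n] unfolding that by blast
      thus ?thesis using W[of i] by auto
    qed
    have mem: "j < 4 ^ m i" "h < 4 ^ K i" "j' < 4 ^ m i'" "h' < 4 ^ K i'"
      using digits[OF gn] digits[OF gn'] by simp_all
    have ne: "(i, j, h) \<noteq> (i', j', h')" using g(1) that gn gn' by (metis injD)
    have P: "(P \<circ> g) n = grid_point (K (Suc i)) (h * 4 ^ m i + j)"
      "(P \<circ> g) n' = grid_point (K (Suc i')) (h' * 4 ^ m i' + j')"
      by (simp_all add: P_def gn gn' K)
    consider "i = i'" | "i < i'" | "i' < i" by linarith
    thus ?thesis
    proof cases
      case 1
      have lt: "h * 4 ^ m i + j < 4 ^ (K i + m i)" if "h < 4 ^ K i" "j < 4 ^ m i" for h j :: nat
      proof -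
        have "h * 4 ^ m i + j < Suc h * 4 ^ m i" using that by simp
        also have "\<dots> \<le> 4 ^ K i * 4 ^ m i" using that by (intro mult_right_mono) auto
        finally show ?thesis by (simp add: power_add)
      qed
      have "h * 4 ^ m i + j \<noteq> h' * 4 ^ m i + j'"
      proof
        assume eq: "h * 4 ^ m i + j = h' * 4 ^ m i + j'"
        hence "(h * 4 ^ m i + j) div 4 ^ m i = (h' * 4 ^ m i + j') div 4 ^ m i" by simp
        hence "h = h'" using mem 1 by simp
        thus False using eq ne 1 by simp
      qed
      thus ?thesis unfolding P K 1[symmetric] using mem[unfolded 1[symmetric]] m2[of i] lt
        by (intro kern_same_grid_le_half) simp_all
    next
      case 2
      \<comment> \<open>A gap of two levels means a depth ratio of at least 16, enough for the
        factor 8 in \<open>kern_distant_circles_le_half\<close>.\<close>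
      have "K (Suc i) + 2 \<le> K (Suc i')"
        using K_mono[of "Suc i" i'] 2 m2[of i'] by (simp add: K)
      thus ?thesis unfolding P by (rule kern_distant_grids_le_half)
    next
      case 3
      have "K (Suc i') + 2 \<le> K (Suc i)"
        using K_mono[of "Suc i'" i] 3 m2[of i] by (simp add: K)
      thus ?thesis unfolding P by (subst kern_commute) (rule kern_distant_grids_le_half)
    qed
  qed
qed

theorem theorem1p4:
  shows "\<exists>b z. bloch b \<and> interpolating z \<and> (\<forall>n. z n \<in> ball 0 1 - {0}) \<and>
    (\<forall>lam::real. lam > 0 \<longrightarrow>
       \<not> summable (\<lambda>n. exp (lam * (norm (b (z n) - b 0))\<^sup>2 / (- ln (1 - (norm (z n))\<^sup>2)))
                        * (1 - (norm (z n))\<^sup>2)))"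
proof -
  obtain e :: "nat \<Rightarrow> real" where e: "\<And>i. 0 < e i" "\<And>i. e i \<le> 1" "summable e"
    and nonsummable: "\<And>\<tau>. \<tau> > 0 \<Longrightarrow> \<not> summable (\<lambda>i. e i powr (1 - \<tau>))"
    using exists_summable_nonsummable_powers by blast
  define s where "s i = Suc (nat \<lfloor>ln (1 / e i) / ln 1024\<rfloor>)" for i
  define K where "K = depth s"
  define m where "m i = s i * (64 * (K i + 2)\<^sup>2)" for i
  have s: "s i > 0" for i by (simp add: s_def)
  have K: "K (Suc i) = K i + m i" for i by (simp add: K_def m_def)
  have "\<exists>W :: nat set. W \<subseteq> {..<4 ^ m i} \<and> (\<forall>j\<in>W. s i * sqrt (64 * (K i + 2)\<^sup>2) / 4 \<le> cos_sum (m i) j) \<and>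
      e i / 1024 \<le> card W / 4 ^ m i \<and> card W / 4 ^ m i \<le> e i + 1 / 4 ^ m i" for i
    using exists_digit_set[OF e(1,2), of i "K i"] by (simp only: m_def s_def)
  then obtain W :: "nat \<Rightarrow> nat set" where W: "\<And>i. W i \<subseteq> {..<4 ^ m i}"
      "\<And>i j. j \<in> W i \<Longrightarrow> s i * sqrt (64 * (K i + 2)\<^sup>2) / 4 \<le> cos_sum (m i) j"
      "\<And>i. e i / 1024 \<le> card (W i) / 4 ^ m i" "\<And>i. card (W i) / 4 ^ m i \<le> e i + 1 / 4 ^ m i"
    by metis
  have finW: "finite (W i)" for i using W(1) finite_subset by blast
  have density: "(\<Sum>i<n. card (W i) / 4 ^ m i) \<le> suminf e + 2" for n
  proof -
    \<comment> \<open>The rounding errors of the densities are summable since the block lengths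
      satisfy \<open>i \<le> m i\<close>.\<close>
    have "1 / 4 ^ m i \<le> (1 / 2 :: real) ^ i" for i
    proof -
      have "i \<le> m i"
        using depth_mono[of s 0 i, OF s] le_block_length[OF s, of "K i" i] by (simp add: K_def m_def)
      hence "(2::real) ^ i \<le> 2 ^ m i" by (intro power_increasing) auto
      also have "\<dots> \<le> 4 ^ m i" by (intro power_mono) auto
      finally show ?thesis by (simp add: power_divide frac_le)
    qed
    hence "(\<Sum>i<n. card (W i) / 4 ^ m i) \<le> (\<Sum>i<n. e i + (1 / 2) ^ i)"
      using W(4) by (intro sum_mono) (meson add_left_mono order_trans)
    also have "\<dots> = (\<Sum>i<n. e i) + (\<Sum>i<n. (1 / 2) ^ i)" by (rule sum.distrib)
    also have "(\<Sum>i<n. e i) \<le> suminf e"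
      using e by (intro sum_le_suminf) (auto intro: less_imp_le)
    also have "(\<Sum>i<n. (1 / 2 :: real) ^ i) \<le> 2" by (simp add: sum_gp_strict)
    finally show ?thesis by simp
  qed
  define I where "I = (SIGMA i:UNIV. W i \<times> {..<(4::nat) ^ K i})"
  have "W i \<noteq> {}" for i
    using W(3)[of i] e(1)[of i] by auto
  hence "fst ` I = UNIV" by (force simp: I_def image_iff)
  hence "infinite I" by (metis finite_imageI infinite_UNIV_nat)
  hence bij: "bij_betw (from_nat_into I) UNIV I"
    by (intro bij_betw_from_nat_into) auto
  define g where "g = from_nat_into I"
  have g: "inj g" "range g = I" using bij by (auto simp: g_def bij_betw_def)
  define P where "P = (\<lambda>(i, j, h). grid_point (K i + m i) (h * 4 ^ m i + j))"
  define z where "z = P \<circ> g"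
  have "interpolating z"
    unfolding z_def P_def m_def K_def
    by (rule interpolating_generations[OF s W(1)[unfolded m_def K_def] density[unfolded m_def K_def] g(1)])
       (simp add: g(2) I_def K_def)
  moreover have "z n \<in> ball 0 1 - {0}" for n
  proof -
    obtain i j h where gn: "g n = (i, j, h)" by (cases "g n")
    \<comment> \<open>Generation \<open>i\<close> lies at depth \<open>K (Suc i)\<close>, not
      \<open>K i\<close>; the origin is avoided although \<open>K 0 = 0\<close>.\<close>
    have "K (Suc i) > 0" using s[of i] by (simp add: K m_def)
    hence "(4::real) ^ 1 \<le> 4 ^ K (Suc i)" by (intro power_increasing) auto
    hence "0 < norm (z n)" by (simp add: z_def P_def gn norm_grid_point flip: K)
    moreover have "norm (z n) < 1" by (simp add: z_def P_def gn norm_grid_point_less_1)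
    ultimately show ?thesis by auto
  qed
  moreover have "\<not> summable (\<lambda>n. exp (lam * (norm (lacunary (z n) - lacunary 0))\<^sup>2 / (- ln (1 - (norm (z n))\<^sup>2)))
                        * (1 - (norm (z n))\<^sup>2))" if lam: "lam > 0" for lam :: real
  proof
    define \<phi> where "\<phi> x = exp (lam * (norm (lacunary x - lacunary 0))\<^sup>2 / (- ln (1 - (norm x)\<^sup>2))) * (1 - (norm x)\<^sup>2)" for x
    assume "summable (\<lambda>n. exp (lam * (norm (lacunary (z n) - lacunary 0))\<^sup>2 / (- ln (1 - (norm (z n))\<^sup>2)))
                        * (1 - (norm (z n))\<^sup>2))"
    hence summ: "summable (\<lambda>n. \<phi> (z n))" by (simp only: \<phi>_def)
    \<comment> \<open>As \<open>s i\<close> is at least ln (1 / e i) / ln 1024, this exponent makes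
      exp (lam * s i / 130) at least (e i) powr (-\<open>\<tau>\<close>).\<close>
    define \<tau> where "\<tau> = lam / (130 * ln 1024)"
    have nn: "0 \<le> \<phi> (P x)" for x
    proof -
      have "norm (P x) < 1" by (simp add: P_def norm_grid_point_less_1 split: prod.split)
      thus ?thesis by (simp add: \<phi>_def power_le_one)
    qed
    have summand: "exp (lam * (s i / 130)) / 4 ^ (K i + m i) \<le> \<phi> (P (i, j, h))" if "j \<in> W i" for i j h
    proof -
      have "lam * (s i / 130) \<le> lam * ((norm (lacunary (P (i, j, h)) - lacunary 0))\<^sup>2 / (- ln (1 - (norm (P (i, j, h)))\<^sup>2)))"
        using lam lacunary_exponent_ge[OF s, of i "K i" j h] W(2)[OF that]
        by (intro mult_left_mono) (auto simp: P_def m_def)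
      hence "exp (lam * (s i / 130)) * (1 / 4 ^ (K i + m i)) \<le> \<phi> (P (i, j, h))"
        unfolding \<phi>_def
        by (intro mult_mono) (auto simp: P_def one_minus_norm_grid_point_sq)
      thus ?thesis by simp
    qed
    have gen: "e i powr (1 - \<tau>) / 1024 \<le> (\<Sum>x\<in>W i \<times> {..<4 ^ K i}. \<phi> (P (i, x)))" for i
    proof -
      have "ln (1 / e i) / ln 1024 \<le> s i" by (simp add: s_def) linarith
      hence "lam / 130 * (ln (1 / e i) / ln 1024) \<le> lam / 130 * s i"
        using lam by (intro mult_left_mono) auto
      hence "- \<tau> * ln (e i) \<le> lam * (s i / 130)" using e(1)[of i] by (simp add: \<tau>_def ln_div)
      hence "e i powr (- \<tau>) \<le> exp (lam * (s i / 130))"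
        using e(1)[of i] by (simp add: powr_def)
      hence "e i / 1024 * e i powr (- \<tau>) \<le> card (W i) / 4 ^ m i * exp (lam * (s i / 130))"
        using W(3)[of i] e(1)[of i] by (intro mult_mono) auto
      \<comment> \<open>The \<open>card (W i) * 4 ^ K i\<close> points, each weighted by
        \<open>1 / 4 ^ (K i + m i)\<close>, have total weight equal to the density of
        \<open>W i\<close>.\<close>
      also have "\<dots> = (\<Sum>x\<in>W i \<times> {..<(4::nat) ^ K i}. exp (lam * (s i / 130)) / 4 ^ (K i + m i))"
        by (simp add: card_cartesian_product power_add)
      also have "\<dots> \<le> (\<Sum>x\<in>W i \<times> {..<4 ^ K i}. \<phi> (P (i, x)))"
        by (intro sum_mono) (use summand in auto)
      also have "e i / 1024 * e i powr (- \<tau>) = e i powr (1 - \<tau>) / 1024"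
        using e(1)[of i] by (simp add: powr_diff powr_minus_divide)
      finally show ?thesis .
    qed
    have "(\<Sum>i<N. e i powr (1 - \<tau>) / 1024) \<le> (\<Sum>n. \<phi> (z n))" for N
    proof -
      define J where "J = (SIGMA i:{..<N}. W i \<times> {..<(4::nat) ^ K i})"
      have J: "finite J" "J \<subseteq> range g" using finW g(2) by (auto simp: J_def I_def)
      have "(\<Sum>i<N. e i powr (1 - \<tau>) / 1024) \<le> (\<Sum>i<N. \<Sum>x\<in>W i \<times> {..<4 ^ K i}. \<phi> (P (i, x)))"
        by (intro sum_mono gen)
      also have "\<dots> = (\<Sum>x\<in>J. \<phi> (P x))"
        unfolding J_def using finW by (subst sum.Sigma) (auto simp: split_def)
      also have "\<dots> = (\<Sum>n\<in>g -` J. \<phi> (z n))"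
        using J g(1) sum.reindex[of g "g -` J" "\<lambda>x. \<phi> (P x)"]
        by (simp add: inj_on_def inj_def z_def image_vimage_eq Int_absorb2)
      also have "\<dots> \<le> (\<Sum>n. \<phi> (z n))"
        using J g(1) summ nn by (intro sum_le_suminf) (auto simp: finite_vimageI z_def)
      finally show ?thesis .
    qed
    hence "summable (\<lambda>i. e i powr (1 - \<tau>) / 1024)"
      by (intro bounded_imp_summable[where B = "\<Sum>n. \<phi> (z n)"]) (auto simp flip: lessThan_Suc_atMost simp del: sum.lessThan_Suc)
    hence "summable (\<lambda>i. e i powr (1 - \<tau>))"
      using summable_mult[of "\<lambda>i. e i powr (1 - \<tau>) / 1024" 1024] by simp
    moreover have "\<tau> > 0" using lam by (simp add: \<tau>_def)
    ultimately show False using nonsummable by blast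
  qed
  ultimately show ?thesis using bloch_lacunary by blast
qed

end
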